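(* Let $q=p^e$ for a prime $p$ and $e\ge0$, and fix $m\in\mathbb{Z}_{\ge0}$. The average of $I_m(Z\cap W)$ as $(Z,W)$ ranges over $\mathrm{OGr}_n(\mathbb{Z}/q\mathbb{Z})^2$ tends to $q^{m(m+1)/2}$ as $n\to\infty$.
   Context: $\mathrm{OGr}_n(\mathbb{Z}/q\mathbb{Z})$ is the (finite) set of direct summands $Z$ of $(\mathbb{Z}/q\mathbb{Z})^{2n}$, free of rank $n$, on which the quadratic form $Q(x_1,\dots,x_n,y_1,\dots,y_n)=\sum_{i=1}^nx_iy_i$ vanishes identically. For a finite $\mathbb{Z}/q\mathbb{Z}$-module $G$, $I_m(G)$ is the number of injective homomorphisms $(\mathbb{Z}/q\mathbb{Z})^m\to G$. *)

theory Defs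
  imports Complex_Main "HOL-Algebra.Algebra"
begin

section \<open>Free modules and linear maps\<close>

text \<open>The module \<open>R\<^sup>k\<close>, with coordinates indexed by \<open>{..<k}\<close>. Vectors are extensional functions,
  so that equality of vectors is equality of all coordinates. The fields \<open>mult\<close> and \<open>one\<close> are
  present only because the library's module record extends the ring record.\<close>

definition free_module :: "('a, 'b) ring_scheme \<Rightarrow> nat \<Rightarrow> ('a, nat \<Rightarrow> 'a) module" where
  "free_module R k =
    \<lparr>carrier = {..<k} \<rightarrow>\<^sub>E carrier R,
     monoid.mult = (\<lambda>x y. \<lambda>i\<in>{..<k}. x i \<otimes>\<^bsub>R\<^esub> y i),
     monoid.one = (\<lambda>i\<in>{..<k}. \<one>\<^bsub>R\<^esub>),
     ring.zero = (\<lambda>i\<in>{..<k}. \<zero>\<^bsub>R\<^esub>),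
     ring.add = (\<lambda>x y. \<lambda>i\<in>{..<k}. x i \<oplus>\<^bsub>R\<^esub> y i),
     module.smult = (\<lambda>a x. \<lambda>i\<in>{..<k}. a \<otimes>\<^bsub>R\<^esub> x i)\<rparr>"

lemma free_module_is_module:
  assumes "cring R"
  shows "module R (free_module R k)"
proof -
  interpret R: cring R by fact
  have eqI: "(\<lambda>i\<in>{..<k}. f i) = (\<lambda>i\<in>{..<k}. g i)" if "\<And>i. i < k \<Longrightarrow> f i = g i" for f g :: "nat \<Rightarrow> 'a"
    using that by (simp cong: restrict_cong)
  have idI: "(\<lambda>i\<in>{..<k}. f i) = x"
    if "x \<in> {..<k} \<rightarrow>\<^sub>E carrier R" "\<And>i. i < k \<Longrightarrow> f i = x i" for f x
    using that by (intro extensionalityI[of _ "{..<k}"]) (auto simp: PiE_def)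
  have mem: "x i \<in> carrier R" if "x \<in> {..<k} \<rightarrow>\<^sub>E carrier R" "i < k" for x i
    using that by auto
  show ?thesis
  proof (rule moduleI)
    show "abelian_group (free_module R k)"
    proof (rule abelian_groupI)
      fix x assume x: "x \<in> carrier (free_module R k)"
      have "(\<lambda>i\<in>{..<k}. \<ominus>\<^bsub>R\<^esub> x i) \<in> carrier (free_module R k)"
        using x by (auto simp: free_module_def)
      moreover have "(\<lambda>i\<in>{..<k}. \<ominus>\<^bsub>R\<^esub> x i) \<oplus>\<^bsub>free_module R k\<^esub> x = \<zero>\<^bsub>free_module R k\<^esub>"
        using x by (simp add: free_module_def) (rule eqI, simp add: mem R.l_neg)
      ultimately show "\<exists>y\<in>carrier (free_module R k). y \<oplus>\<^bsub>free_module R k\<^esub> x = \<zero>\<^bsub>free_module R k\<^esub>"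
        by blast
    next
      fix x y z
      assume "x \<in> carrier (free_module R k)" "y \<in> carrier (free_module R k)"
        "z \<in> carrier (free_module R k)"
      then show "(x \<oplus>\<^bsub>free_module R k\<^esub> y) \<oplus>\<^bsub>free_module R k\<^esub> z =
          x \<oplus>\<^bsub>free_module R k\<^esub> (y \<oplus>\<^bsub>free_module R k\<^esub> z)"
        by (simp add: free_module_def) (rule eqI, simp add: mem R.a_assoc)
    next
      fix x y
      assume "x \<in> carrier (free_module R k)" "y \<in> carrier (free_module R k)"
      then show "x \<oplus>\<^bsub>free_module R k\<^esub> y = y \<oplus>\<^bsub>free_module R k\<^esub> x"
        by (simp add: free_module_def) (rule eqI, simp add: mem R.a_comm)
    next
      fix x
      assume "x \<in> carrier (free_module R k)"
      then show "\<zero>\<^bsub>free_module R k\<^esub> \<oplus>\<^bsub>free_module R k\<^esub> x = x"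
        by (simp add: free_module_def) (rule idI, assumption, simp add: mem)
    next
      fix x y
      assume "x \<in> carrier (free_module R k)" "y \<in> carrier (free_module R k)"
      then show "x \<oplus>\<^bsub>free_module R k\<^esub> y \<in> carrier (free_module R k)"
        by (auto simp: free_module_def)
    next
      show "\<zero>\<^bsub>free_module R k\<^esub> \<in> carrier (free_module R k)"
        by (auto simp: free_module_def)
    qed
  next
    fix a x
    assume "a \<in> carrier R" "x \<in> carrier (free_module R k)"
    then show "a \<odot>\<^bsub>free_module R k\<^esub> x \<in> carrier (free_module R k)"
      by (auto simp: free_module_def)
  next
    fix a b x
    assume "a \<in> carrier R" "b \<in> carrier R" "x \<in> carrier (free_module R k)"
    then show "(a \<oplus>\<^bsub>R\<^esub> b) \<odot>\<^bsub>free_module R k\<^esub> x =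
        a \<odot>\<^bsub>free_module R k\<^esub> x \<oplus>\<^bsub>free_module R k\<^esub> b \<odot>\<^bsub>free_module R k\<^esub> x"
      and "(a \<otimes>\<^bsub>R\<^esub> b) \<odot>\<^bsub>free_module R k\<^esub> x =
        a \<odot>\<^bsub>free_module R k\<^esub> (b \<odot>\<^bsub>free_module R k\<^esub> x)"
      by (simp_all add: free_module_def)
        (rule eqI, simp add: mem R.l_distr R.m_assoc)+
  next
    fix a x y
    assume "a \<in> carrier R" "x \<in> carrier (free_module R k)" "y \<in> carrier (free_module R k)"
    then show "a \<odot>\<^bsub>free_module R k\<^esub> (x \<oplus>\<^bsub>free_module R k\<^esub> y) =
        a \<odot>\<^bsub>free_module R k\<^esub> x \<oplus>\<^bsub>free_module R k\<^esub> a \<odot>\<^bsub>free_module R k\<^esub> y"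
      by (simp add: free_module_def) (rule eqI, simp add: mem R.r_distr)
  next
    fix x
    assume "x \<in> carrier (free_module R k)"
    then show "\<one>\<^bsub>R\<^esub> \<odot>\<^bsub>free_module R k\<^esub> x = x"
      by (simp add: free_module_def) (rule idI, assumption, simp add: mem)
  qed (fact assms)
qed

text \<open>Linear maps are taken to be extensional, so that each is represented by exactly one function
  and sets of linear maps may be counted.\<close>

definition module_hom ::
  "('a, 'r) ring_scheme \<Rightarrow> ('a, 'b, 's) module_scheme \<Rightarrow> ('a, 'c, 't) module_scheme \<Rightarrow> ('b \<Rightarrow> 'c) set"
  where
  "module_hom R M N =
    {f \<in> carrier M \<rightarrow>\<^sub>E carrier N.
      (\<forall>x\<in>carrier M. \<forall>y\<in>carrier M. f (x \<oplus>\<^bsub>M\<^esub> y) = f x \<oplus>\<^bsub>N\<^esub> f y) \<and>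
      (\<forall>a\<in>carrier R. \<forall>x\<in>carrier M. f (a \<odot>\<^bsub>M\<^esub> x) = a \<odot>\<^bsub>N\<^esub> f x)}"

text \<open>Over the zero ring, the zero module is free of every rank.\<close>

definition free_of_rank ::
  "('a, 'r) ring_scheme \<Rightarrow> ('a, 'b, 's) module_scheme \<Rightarrow> nat \<Rightarrow> bool" where
  "free_of_rank R M k \<longleftrightarrow>
    (\<exists>f \<in> module_hom R (free_module R k) M. bij_betw f (carrier (free_module R k)) (carrier M))"

definition direct_summand ::
  "'b set \<Rightarrow> ('a, 'r) ring_scheme \<Rightarrow> ('a, 'b, 's) module_scheme \<Rightarrow> bool" where
  "direct_summand Z R M \<longleftrightarrow>
    submodule Z R M \<and>
    (\<exists>N. submodule N R M \<and> Z \<inter> N = {\<zero>\<^bsub>M\<^esub>} \<and> Z <+>\<^bsub>M\<^esub> N = carrier M)"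

definition num_injective_homs ::
  "('a, 'r) ring_scheme \<Rightarrow> nat \<Rightarrow> ('a, 'b, 's) module_scheme \<Rightarrow> nat" where
  "num_injective_homs R m G =
    card {f \<in> module_hom R (free_module R m) G. inj_on f (carrier (free_module R m))}"


section \<open>The orthogonal Grassmannian\<close>

text \<open>A vector of \<open>R\<^sup>2\<^sup>n\<close> is \<open>(x\<^sub>1, \<dots>, x\<^sub>n, y\<^sub>1, \<dots>, y\<^sub>n)\<close>: coordinates \<open>0, \<dots>, n - 1\<close> are the
  \<open>x\<close>'s and coordinates \<open>n, \<dots>, 2 n - 1\<close> are the \<open>y\<close>'s.\<close>

definition hyperbolic_form :: "('a, 'r) ring_scheme \<Rightarrow> nat \<Rightarrow> (nat \<Rightarrow> 'a) \<Rightarrow> 'a" where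
  "hyperbolic_form R n v = (\<Oplus>\<^bsub>R\<^esub>i\<in>{..<n}. v i \<otimes>\<^bsub>R\<^esub> v (n + i))"

definition OGr :: "('a, 'r) ring_scheme \<Rightarrow> nat \<Rightarrow> (nat \<Rightarrow> 'a) set set" where
  "OGr R n =
    {Z. direct_summand Z R (free_module R (2 * n)) \<and>
        free_of_rank R ((free_module R (2 * n))\<lparr>carrier := Z\<rparr>) n \<and>
        (\<forall>v\<in>Z. hyperbolic_form R n v = \<zero>\<^bsub>R\<^esub>)}"

definition average_injective_homs :: "('a, 'r) ring_scheme \<Rightarrow> nat \<Rightarrow> nat \<Rightarrow> real" where
  "average_injective_homs R m n =
    (\<Sum>(Z, W) \<in> OGr R n \<times> OGr R n.
       real (num_injective_homs R m ((free_module R (2 * n))\<lparr>carrier := Z \<inter> W\<rparr>))) /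
    real (card (OGr R n \<times> OGr R n))"

end

theory Submission
  imports Defs
begin

text \<open>Let \<open>N\<close> be the number of injective maps \<open>R\<^sup>m \<rightarrow> R\<^sup>2\<^sup>n\<close> with isotropic image and \<open>I = I\<^sub>m(R\<^sup>n)\<close>.
  Isometries act transitively on these maps, so that the number \<open>c\<close> of members of the Grassmannian that
  contain the image of such a map does not depend on the map. Counting pairs (map, \<open>Z\<close>) gives
  \<open>N c = |OGr| I\<close>, and counting triples (map, \<open>Z\<close>, \<open>W\<close>) shows that the average is
  \<open>N c\<^sup>2 / |OGr|\<^sup>2 = I\<^sup>2 / N\<close>.

  Write a map to \<open>R\<^sup>2\<^sup>n\<close> as a pair of \<open>n \<times> m\<close> matrices \<open>A\<close>, \<open>Y\<close>. It has isotropic image if and only if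
  \<open>A\<^sup>T Y\<close> is alternating. For almost all \<open>A\<close> every standard basis vector of \<open>R\<^sup>m\<close> is a row of \<open>A\<close>; then
  the map is injective, and exactly one in \<open>q ^ (m (m + 1) / 2)\<close> of all \<open>Y\<close> is admissible. So \<open>I\<close> is
  asymptotic to \<open>q ^ (n m)\<close> and \<open>N\<close> to \<open>q ^ (2 n m - m (m + 1) / 2)\<close>.\<close>

section \<open>Free modules\<close>

text \<open>Neither \<open>|OGr|\<close> nor the number of members of the Grassmannian that contain
  a given image is easy to compute; both cancel from the average, so only maps between free modules
  are ever counted. Since \<open>p = 2\<close> is allowed, the quadratic form cannot be recovered
  from its polar form. Hence no step divides by 2, the matrix condition is "alternating" rather than
  "skew", and reflections are formed only in vectors on which \<open>Q\<close> is a unit.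
  Transitivity needs a local ring. Locality enters through a single nonzero element \<open>s\<close>
  that annihilates all nonunits, namely \<open>p ^ (e - 1)\<close> modulo \<open>p ^ e\<close>.
  Multiplication by \<open>s\<close> is the device by which injectivity of a map forces a unit
  coordinate in the image of a basis vector. For \<open>e = 0\<close> the ring is zero and has no
  such \<open>s\<close>; that case is settled separately. The exponent \<open>m (m + 1) / 2\<close>
  is the number of equations in "alternating": \<open>m\<close> on the diagonal and
  \<open>m (m - 1) / 2\<close> off it. If every basis vector is a row of \<open>A\<close>, each
  equation can be solved for an entry of \<open>Y\<close> of its own.\<close>

lemma free_module_sel:
  "carrier (free_module R k) = {..<k} \<rightarrow>\<^sub>E carrier R"
  "\<zero>\<^bsub>free_module R k\<^esub> = (\<lambda>i\<in>{..<k}. \<zero>\<^bsub>R\<^esub>)"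
  "x \<oplus>\<^bsub>free_module R k\<^esub> y = (\<lambda>i\<in>{..<k}. x i \<oplus>\<^bsub>R\<^esub> y i)"
  "a \<odot>\<^bsub>free_module R k\<^esub> x = (\<lambda>i\<in>{..<k}. a \<otimes>\<^bsub>R\<^esub> x i)"
  by (simp_all add: free_module_def)

text \<open>For \<open>i \<ge> k\<close> this is the zero vector, so that it lies in the module for
  every index.\<close>

definition unit_vec :: "('a, 'r) ring_scheme \<Rightarrow> nat \<Rightarrow> nat \<Rightarrow> nat \<Rightarrow> 'a" where
  "unit_vec R k i = (\<lambda>l\<in>{..<k}. if l = i then \<one>\<^bsub>R\<^esub> else \<zero>\<^bsub>R\<^esub>)"

definition dot :: "('a, 'r) ring_scheme \<Rightarrow> nat \<Rightarrow> (nat \<Rightarrow> 'a) \<Rightarrow> (nat \<Rightarrow> 'a) \<Rightarrow> 'a" where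
  "dot R m x y = (\<Oplus>\<^bsub>R\<^esub>i\<in>{..<m}. x i \<otimes>\<^bsub>R\<^esub> y i)"

lemma vec_eqI:
  assumes "x \<in> {..<k} \<rightarrow>\<^sub>E A" "y \<in> {..<k} \<rightarrow>\<^sub>E B" "\<And>i. i < k \<Longrightarrow> x i = y i"
  shows "x = y"
proof (rule extensionalityI)
  show "x \<in> extensional {..<k}" "y \<in> extensional {..<k}"
    using assms(1,2) by (simp_all add: PiE_def)
qed (simp add: assms(3))

lemma unit_vec_apply [simp]: "l < k \<Longrightarrow> unit_vec R k i l = (if l = i then \<one>\<^bsub>R\<^esub> else \<zero>\<^bsub>R\<^esub>)"
  by (simp add: unit_vec_def)

lemma module_homI:
  assumes "f \<in> extensional (carrier M)" "\<And>x. x \<in> carrier M \<Longrightarrow> f x \<in> carrier N"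
    "\<And>x y. x \<in> carrier M \<Longrightarrow> y \<in> carrier M \<Longrightarrow> f (x \<oplus>\<^bsub>M\<^esub> y) = f x \<oplus>\<^bsub>N\<^esub> f y"
    "\<And>a x. a \<in> carrier R \<Longrightarrow> x \<in> carrier M \<Longrightarrow> f (a \<odot>\<^bsub>M\<^esub> x) = a \<odot>\<^bsub>N\<^esub> f x"
  shows "f \<in> module_hom R M N"
  using assms unfolding module_hom_def PiE_def by blast

lemma module_homD:
  assumes "f \<in> module_hom R M N"
  shows "x \<in> carrier M \<Longrightarrow> f x \<in> carrier N"
    "x \<in> carrier M \<Longrightarrow> y \<in> carrier M \<Longrightarrow> f (x \<oplus>\<^bsub>M\<^esub> y) = f x \<oplus>\<^bsub>N\<^esub> f y"
    "a \<in> carrier R \<Longrightarrow> x \<in> carrier M \<Longrightarrow> f (a \<odot>\<^bsub>M\<^esub> x) = a \<odot>\<^bsub>N\<^esub> f x"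
    "f \<in> extensional (carrier M)"
  using assms unfolding module_hom_def PiE_def by blast+

lemma module_hom_compose:
  assumes f: "f \<in> module_hom R L M" and g: "g \<in> module_hom R M N"
    and L: "\<And>x y. x \<in> carrier L \<Longrightarrow> y \<in> carrier L \<Longrightarrow> x \<oplus>\<^bsub>L\<^esub> y \<in> carrier L"
      "\<And>a x. a \<in> carrier R \<Longrightarrow> x \<in> carrier L \<Longrightarrow> a \<odot>\<^bsub>L\<^esub> x \<in> carrier L"
  shows "compose (carrier L) g f \<in> module_hom R L N"
  by (rule module_homI)
    (simp_all add: compose_def L module_homD(1-3)[OF f] module_homD(1-3)[OF g])

lemma inj_on_compose_hom:
  assumes f: "f \<in> module_hom R L M" and inj: "inj_on f (carrier L)" "inj_on g (carrier M)"
  shows "inj_on (compose (carrier L) g f) (carrier L)"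
proof (rule inj_onI)
  fix x y assume xy: "x \<in> carrier L" "y \<in> carrier L"
    and "compose (carrier L) g f x = compose (carrier L) g f y"
  then have "g (f x) = g (f y)" by (simp add: compose_def)
  then have "f x = f y"
    using inj_onD[OF inj(2)] module_homD(1)[OF f] xy by blast
  then show "x = y" using inj_onD[OF inj(1)] xy by blast
qed

context cring
begin

lemma free_module_closed:
  "x \<in> carrier (free_module R k) \<Longrightarrow> y \<in> carrier (free_module R k) \<Longrightarrow>
     x \<oplus>\<^bsub>free_module R k\<^esub> y \<in> carrier (free_module R k)"
  "a \<in> carrier R \<Longrightarrow> x \<in> carrier (free_module R k) \<Longrightarrow>
     a \<odot>\<^bsub>free_module R k\<^esub> x \<in> carrier (free_module R k)"
  by (auto simp: free_module_sel)

lemma module_free_module: "module R (free_module R k)"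
  by (simp add: free_module_is_module is_cring)

lemma unit_vec_closed [simp]: "unit_vec R k i \<in> carrier (free_module R k)"
  by (auto simp: unit_vec_def free_module_sel)

text \<open>Restoring the coordinates of \<open>x\<close> one at a time leads from zero to
  \<open>x\<close> by adding scaled basis vectors. Linear maps can thus be handled through their
  values on the basis without finite sums of vectors.\<close>

lemma free_module_induct [consumes 1, case_names zero add]:
  assumes x: "x \<in> carrier (free_module R k)"
    and zero: "P \<zero>\<^bsub>free_module R k\<^esub>"
    and add: "\<And>x a i. x \<in> carrier (free_module R k) \<Longrightarrow> P x \<Longrightarrow> a \<in> carrier R \<Longrightarrow> i < k \<Longrightarrow>
      P (x \<oplus>\<^bsub>free_module R k\<^esub> a \<odot>\<^bsub>free_module R k\<^esub> unit_vec R k i)"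
  shows "P x"
proof -
  define t where "t j = (\<lambda>l\<in>{..<k}. if l < j then x l else \<zero>)" for j
  have t: "t j \<in> carrier (free_module R k)" for j
    using x by (auto simp: t_def PiE_iff free_module_sel)
  have "j \<le> k \<Longrightarrow> P (t j)" for j
  proof (induction j)
    case 0
    have "t 0 = \<zero>\<^bsub>free_module R k\<^esub>" by (auto simp: t_def free_module_sel)
    then show ?case using zero by (simp only:)
  next
    case (Suc j)
    have xj: "x j \<in> carrier R" using x Suc.prems by (auto simp: PiE_iff free_module_sel)
    have "t (Suc j) = t j \<oplus>\<^bsub>free_module R k\<^esub> x j \<odot>\<^bsub>free_module R k\<^esub> unit_vec R k j"
    proof (rule vec_eqI)
      show "t (Suc j) \<in> {..<k} \<rightarrow>\<^sub>E carrier R" using t[of "Suc j"] by (simp add: free_module_sel)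
      show "t j \<oplus>\<^bsub>free_module R k\<^esub> x j \<odot>\<^bsub>free_module R k\<^esub> unit_vec R k j \<in> {..<k} \<rightarrow>\<^sub>E carrier R"
        using t[of j] xj by (auto simp: free_module_sel PiE_iff)
    next
      fix l assume l: "l < k"
      then have "x l \<in> carrier R" using x by (auto simp: free_module_sel)
      then show "t (Suc j) l = (t j \<oplus>\<^bsub>free_module R k\<^esub> x j \<odot>\<^bsub>free_module R k\<^esub> unit_vec R k j) l"
        using l xj by (cases "l = j") (auto simp: t_def free_module_sel)
    qed
    then show ?case using add[OF t _ xj] Suc by simp
  qed
  moreover have "t k = x"
    using x t by (intro vec_eqI[of _ k "carrier R" _ "carrier R"]) (auto simp: t_def free_module_sel)
  ultimately show ?thesis by (metis order_refl)
qed

lemma module_hom_zero: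
  assumes f: "f \<in> module_hom R (free_module R k) M" and M: "module R M"
  shows "f \<zero>\<^bsub>free_module R k\<^esub> = \<zero>\<^bsub>M\<^esub>"
proof -
  interpret M: module R M by fact
  interpret F: module R "free_module R k" by (rule module_free_module)
  have z: "\<zero>\<^bsub>free_module R k\<^esub> \<in> carrier (free_module R k)" by (rule F.zero_closed)
  have "f \<zero>\<^bsub>free_module R k\<^esub> = f (\<zero> \<odot>\<^bsub>free_module R k\<^esub> \<zero>\<^bsub>free_module R k\<^esub>)"
    by (simp only: F.smult_l_null[OF z])
  also have "\<dots> = \<zero> \<odot>\<^bsub>M\<^esub> f \<zero>\<^bsub>free_module R k\<^esub>"
    by (rule module_homD(3)[OF f zero_closed z])
  also have "\<dots> = \<zero>\<^bsub>M\<^esub>"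
    by (rule M.smult_l_null[OF module_homD(1)[OF f z]])
  finally show ?thesis .
qed

lemma module_hom_add_smult:
  assumes f: "f \<in> module_hom R (free_module R k) M" and x: "x \<in> carrier (free_module R k)"
    and a: "a \<in> carrier R" and y: "y \<in> carrier (free_module R k)"
  shows "f (x \<oplus>\<^bsub>free_module R k\<^esub> a \<odot>\<^bsub>free_module R k\<^esub> y) = f x \<oplus>\<^bsub>M\<^esub> a \<odot>\<^bsub>M\<^esub> f y"
  using module_homD(2)[OF f x free_module_closed(2)[OF a y]] module_homD(3)[OF f a y] by simp

lemma module_hom_in_submodule:
  assumes f: "f \<in> module_hom R (free_module R k) M" and M: "module R M" and N: "submodule N R M"
    and basis: "\<And>i. i < k \<Longrightarrow> f (unit_vec R k i) \<in> N" and x: "x \<in> carrier (free_module R k)"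
  shows "f x \<in> N"
  using x
proof (induction rule: free_module_induct)
  case zero
  show ?case
    using subgroup.one_closed[OF submodule.axioms(1)[OF N]] by (simp only: module_hom_zero[OF f M]) simp
next
  case (add x a i)
  note E = module.submoduleE[OF M N]
  show ?case
    unfolding module_hom_add_smult[OF f add.hyps(1,2) unit_vec_closed] using add E(4,5) basis by blast
qed

lemma module_hom_eqI:
  assumes f: "f \<in> module_hom R (free_module R k) M" and g: "g \<in> module_hom R (free_module R k) M"
    and M: "module R M" and basis: "\<And>i. i < k \<Longrightarrow> f (unit_vec R k i) = g (unit_vec R k i)"
  shows "f = g"
proof (rule extensionalityI[OF module_homD(4)[OF f] module_homD(4)[OF g]])
  fix x assume "x \<in> carrier (free_module R k)"
  then show "f x = g x"
  proof (induction rule: free_module_induct)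
    case zero
    show ?case by (simp only: module_hom_zero[OF f M] module_hom_zero[OF g M])
  next
    case (add x a i)
    show ?case
      unfolding module_hom_add_smult[OF f add.hyps(1,2) unit_vec_closed]
        module_hom_add_smult[OF g add.hyps(1,2) unit_vec_closed]
      using add basis by simp
  qed
qed

lemma dot_closed [simp]:
  "x \<in> {..<m} \<rightarrow>\<^sub>E carrier R \<Longrightarrow> y \<in> {..<m} \<rightarrow>\<^sub>E carrier R \<Longrightarrow> dot R m x y \<in> carrier R"
  unfolding dot_def by (rule finsum_closed) (auto simp: PiE_iff)

lemma dot_unit_vec [simp]:
  assumes x: "x \<in> {..<m} \<rightarrow>\<^sub>E carrier R" and i: "i < m"
  shows "dot R m x (unit_vec R m i) = x i" "dot R m (unit_vec R m i) x = x i"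
proof -
  have c: "x l \<in> carrier R" if "l < m" for l using x that by auto
  have "dot R m x (unit_vec R m i) = (\<Oplus>l\<in>{..<m}. if i = l then x l else \<zero>)"
    unfolding dot_def by (rule finsum_cong') (auto simp: c)
  also have "\<dots> = x i"
    using i c by (intro add.finprod_singleton) auto
  finally show "dot R m x (unit_vec R m i) = x i" .
  have "dot R m (unit_vec R m i) x = (\<Oplus>l\<in>{..<m}. if i = l then x l else \<zero>)"
    unfolding dot_def by (rule finsum_cong') (auto simp: c)
  also have "\<dots> = x i"
    using i c by (intro add.finprod_singleton) auto
  finally show "dot R m (unit_vec R m i) x = x i" .
qed

lemma dot_add:
  assumes "x \<in> {..<m} \<rightarrow>\<^sub>E carrier R" "y \<in> {..<m} \<rightarrow>\<^sub>E carrier R" "z \<in> {..<m} \<rightarrow>\<^sub>E carrier R"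
  shows "dot R m x (\<lambda>i\<in>{..<m}. y i \<oplus> z i) = dot R m x y \<oplus> dot R m x z"
proof -
  have c: "x l \<in> carrier R" "y l \<in> carrier R" "z l \<in> carrier R" if "l < m" for l
    using assms that by auto
  have "dot R m x (\<lambda>i\<in>{..<m}. y i \<oplus> z i) = (\<Oplus>i\<in>{..<m}. x i \<otimes> y i \<oplus> x i \<otimes> z i)"
    unfolding dot_def by (rule finsum_cong') (auto simp: c r_distr)
  then show ?thesis
    unfolding dot_def using c by (subst finsum_addf[symmetric]) auto
qed

lemma dot_smult:
  assumes "x \<in> {..<m} \<rightarrow>\<^sub>E carrier R" "y \<in> {..<m} \<rightarrow>\<^sub>E carrier R" "a \<in> carrier R"
  shows "dot R m x (\<lambda>i\<in>{..<m}. a \<otimes> y i) = a \<otimes> dot R m x y"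
proof -
  have c: "x l \<in> carrier R" "y l \<in> carrier R" if "l < m" for l
    using assms that by auto
  have "dot R m x (\<lambda>i\<in>{..<m}. a \<otimes> y i) = (\<Oplus>i\<in>{..<m}. a \<otimes> (x i \<otimes> y i))"
    unfolding dot_def by (rule finsum_cong') (auto simp: c m_lcomm assms)
  then show ?thesis
    unfolding dot_def using c assms by (subst finsum_rdistr) auto
qed

end

section \<open>Isometries of the hyperbolic form\<close>

text \<open>The bilinear form \<open>Q(x + y) - Q(x) - Q(y)\<close> of the hyperbolic form, written
  out in coordinates.\<close>

definition polar_form :: "('a, 'r) ring_scheme \<Rightarrow> nat \<Rightarrow> (nat \<Rightarrow> 'a) \<Rightarrow> (nat \<Rightarrow> 'a) \<Rightarrow> 'a" where
  "polar_form R n x y = (\<Oplus>\<^bsub>R\<^esub>i\<in>{..<n}. x i \<otimes>\<^bsub>R\<^esub> y (n + i) \<oplus>\<^bsub>R\<^esub> x (n + i) \<otimes>\<^bsub>R\<^esub> y i)"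

definition isometries :: "('a, 'r) ring_scheme \<Rightarrow> nat \<Rightarrow> ((nat \<Rightarrow> 'a) \<Rightarrow> nat \<Rightarrow> 'a) set" where
  "isometries R n = {g \<in> module_hom R (free_module R (2 * n)) (free_module R (2 * n)).
     bij_betw g (carrier (free_module R (2 * n))) (carrier (free_module R (2 * n))) \<and>
     (\<forall>x\<in>carrier (free_module R (2 * n)). hyperbolic_form R n (g x) = hyperbolic_form R n x)}"

context cring
begin

lemma hyperbolic_form_closed [simp]:
  "x \<in> carrier (free_module R (2 * n)) \<Longrightarrow> hyperbolic_form R n x \<in> carrier R"
  unfolding hyperbolic_form_def by (rule finsum_closed) (auto simp: free_module_sel PiE_iff)

lemma polar_form_closed [simp]:
  "x \<in> carrier (free_module R (2 * n)) \<Longrightarrow> y \<in> carrier (free_module R (2 * n)) \<Longrightarrow>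
    polar_form R n x y \<in> carrier R"
  unfolding polar_form_def by (rule finsum_closed) (auto simp: free_module_sel PiE_iff)

lemma hyperbolic_form_add:
  assumes x: "x \<in> carrier (free_module R (2 * n))" and y: "y \<in> carrier (free_module R (2 * n))"
  shows "hyperbolic_form R n (x \<oplus>\<^bsub>free_module R (2 * n)\<^esub> y) =
    hyperbolic_form R n x \<oplus> hyperbolic_form R n y \<oplus> polar_form R n x y"
proof -
  have c: "x l \<in> carrier R" "y l \<in> carrier R" if "l < 2 * n" for l
    using x y that by (auto simp: free_module_sel)
  have id: "(a \<oplus> b) \<otimes> (a' \<oplus> b') = (a \<otimes> a' \<oplus> b \<otimes> b') \<oplus> (a \<otimes> b' \<oplus> a' \<otimes> b)"
    if "a \<in> carrier R" "a' \<in> carrier R" "b \<in> carrier R" "b' \<in> carrier R" for a a' b b'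
    using that by (simp add: l_distr r_distr m_ac a_ac)
  have "hyperbolic_form R n (x \<oplus>\<^bsub>free_module R (2 * n)\<^esub> y) =
      (\<Oplus>i\<in>{..<n}. (x i \<otimes> x (n + i) \<oplus> y i \<otimes> y (n + i)) \<oplus> (x i \<otimes> y (n + i) \<oplus> x (n + i) \<otimes> y i))"
    unfolding hyperbolic_form_def by (rule finsum_cong') (auto simp: c id free_module_sel)
  then show ?thesis
    unfolding hyperbolic_form_def polar_form_def by (simp add: finsum_addf c Pi_def)
qed

lemma hyperbolic_form_smult:
  assumes x: "x \<in> carrier (free_module R (2 * n))" and a: "a \<in> carrier R"
  shows "hyperbolic_form R n (a \<odot>\<^bsub>free_module R (2 * n)\<^esub> x) = a \<otimes> a \<otimes> hyperbolic_form R n x"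
proof -
  have c: "x l \<in> carrier R" if "l < 2 * n" for l
    using x that by (auto simp: free_module_sel)
  have id: "(a \<otimes> b) \<otimes> (a \<otimes> b') = (a \<otimes> a) \<otimes> (b \<otimes> b')"
    if "b \<in> carrier R" "b' \<in> carrier R" for b b'
    using that a by (simp add: m_ac)
  have "hyperbolic_form R n (a \<odot>\<^bsub>free_module R (2 * n)\<^esub> x) =
      (\<Oplus>i\<in>{..<n}. (a \<otimes> a) \<otimes> (x i \<otimes> x (n + i)))"
    unfolding hyperbolic_form_def by (rule finsum_cong') (auto simp: c id a free_module_sel)
  also have "\<dots> = a \<otimes> a \<otimes> hyperbolic_form R n x"
    unfolding hyperbolic_form_def using a c by (subst finsum_rdistr) auto
  finally show ?thesis .
qed

lemma polar_form_commute:
  assumes x: "x \<in> carrier (free_module R (2 * n))" and y: "y \<in> carrier (free_module R (2 * n))"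
  shows "polar_form R n x y = polar_form R n y x"
proof -
  have c: "x l \<in> carrier R" "y l \<in> carrier R" if "l < 2 * n" for l
    using x y that by (auto simp: free_module_sel)
  show ?thesis
    unfolding polar_form_def by (rule finsum_cong') (auto simp: c m_comm a_comm)
qed

lemma polar_form_add:
  assumes x: "x \<in> carrier (free_module R (2 * n))" and y: "y \<in> carrier (free_module R (2 * n))"
    and z: "z \<in> carrier (free_module R (2 * n))"
  shows "polar_form R n z (x \<oplus>\<^bsub>free_module R (2 * n)\<^esub> y) = polar_form R n z x \<oplus> polar_form R n z y"
proof -
  have c: "x l \<in> carrier R" "y l \<in> carrier R" "z l \<in> carrier R" if "l < 2 * n" for l
    using x y z that by (auto simp: free_module_sel)
  have id: "c \<otimes> (a \<oplus> b) \<oplus> c' \<otimes> (a' \<oplus> b') = (c \<otimes> a \<oplus> c' \<otimes> a') \<oplus> (c \<otimes> b \<oplus> c' \<otimes> b')"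
    if "a \<in> carrier R" "a' \<in> carrier R" "b \<in> carrier R" "b' \<in> carrier R"
      "c \<in> carrier R" "c' \<in> carrier R" for a a' b b' c c'
    using that by (simp add: r_distr a_ac)
  have "polar_form R n z (x \<oplus>\<^bsub>free_module R (2 * n)\<^esub> y) =
      (\<Oplus>i\<in>{..<n}. (z i \<otimes> x (n + i) \<oplus> z (n + i) \<otimes> x i) \<oplus> (z i \<otimes> y (n + i) \<oplus> z (n + i) \<otimes> y i))"
    unfolding polar_form_def by (rule finsum_cong') (auto simp: c id free_module_sel)
  then show ?thesis
    unfolding polar_form_def by (simp add: finsum_addf c Pi_def)
qed

lemma polar_form_smult:
  assumes x: "x \<in> carrier (free_module R (2 * n))" and z: "z \<in> carrier (free_module R (2 * n))"
    and a: "a \<in> carrier R"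
  shows "polar_form R n z (a \<odot>\<^bsub>free_module R (2 * n)\<^esub> x) = a \<otimes> polar_form R n z x"
proof -
  have c: "x l \<in> carrier R" "z l \<in> carrier R" if "l < 2 * n" for l
    using x z that by (auto simp: free_module_sel)
  have id: "c \<otimes> (a \<otimes> b) \<oplus> c' \<otimes> (a \<otimes> b') = a \<otimes> (c \<otimes> b \<oplus> c' \<otimes> b')"
    if "b \<in> carrier R" "b' \<in> carrier R" "c \<in> carrier R" "c' \<in> carrier R" for b b' c c'
    using that a by (simp add: r_distr m_ac)
  have "polar_form R n z (a \<odot>\<^bsub>free_module R (2 * n)\<^esub> x) =
      (\<Oplus>i\<in>{..<n}. a \<otimes> (z i \<otimes> x (n + i) \<oplus> z (n + i) \<otimes> x i))"
    unfolding polar_form_def by (rule finsum_cong') (auto simp: c id a free_module_sel)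
  also have "\<dots> = a \<otimes> polar_form R n z x"
    unfolding polar_form_def using a c by (subst finsum_rdistr) auto
  finally show ?thesis .
qed

lemma polar_form_self:
  assumes x: "x \<in> carrier (free_module R (2 * n))"
  shows "polar_form R n x x = hyperbolic_form R n x \<oplus> hyperbolic_form R n x"
proof -
  have c: "x l \<in> carrier R" if "l < 2 * n" for l
    using x that by (auto simp: free_module_sel)
  have "polar_form R n x x = (\<Oplus>i\<in>{..<n}. x i \<otimes> x (n + i) \<oplus> x i \<otimes> x (n + i))"
    unfolding polar_form_def by (rule finsum_cong') (auto simp: c m_comm)
  then show ?thesis
    unfolding hyperbolic_form_def by (simp add: finsum_addf c Pi_def)
qed

text \<open>Pairing with a basis vector reads off the coordinate at its hyperbolic partner. This
  translates between conditions on coordinates and orthogonality to basis vectors.\<close>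

lemma polar_form_unit_vec:
  assumes x: "x \<in> carrier (free_module R (2 * n))" and l: "l < 2 * n"
  shows "polar_form R n x (unit_vec R (2 * n) l) = x (if l < n then n + l else l - n)"
proof -
  have c: "x l \<in> carrier R" if "l < 2 * n" for l
    using x that by (auto simp: free_module_sel)
  define l' where "l' = (if l < n then l else l - n)"
  have "polar_form R n x (unit_vec R (2 * n) l) =
      (\<Oplus>i\<in>{..<n}. if l' = i then x (if l < n then n + i else i) else \<zero>)"
    unfolding polar_form_def by (rule finsum_cong') (use l in \<open>auto simp: c l'_def\<close>)
  also have "\<dots> = x (if l < n then n + l' else l')"
    using l c by (intro add.finprod_singleton) (auto simp: l'_def)
  finally show ?thesis by (simp add: l'_def split: if_splits)
qed

lemma hyperbolic_form_unit_vec: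
  assumes l: "l < 2 * n"
  shows "hyperbolic_form R n (unit_vec R (2 * n) l) = \<zero>"
proof -
  have "hyperbolic_form R n (unit_vec R (2 * n) l) = (\<Oplus>i\<in>{..<n}. \<zero>)"
    unfolding hyperbolic_form_def by (rule finsum_cong') auto
  then show ?thesis by simp
qed

lemma isometries_compose:
  assumes f: "f \<in> isometries R n" and g: "g \<in> isometries R n"
  shows "compose (carrier (free_module R (2 * n))) g f \<in> isometries R n"
proof -
  have "compose (carrier (free_module R (2 * n))) g f
      \<in> module_hom R (free_module R (2 * n)) (free_module R (2 * n))"
    using assms by (intro module_hom_compose[OF _ _ free_module_closed]) (auto simp: isometries_def)
  then show ?thesis
    using assms bij_betw_compose[of f "carrier (free_module R (2 * n))" _ g]
    by (auto simp: isometries_def compose_def module_homD(1))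
qed

lemma restrict_id_isometry: "(\<lambda>x\<in>carrier (free_module R (2 * n)). x) \<in> isometries R n"
  unfolding isometries_def
  by (auto intro!: module_homI simp: free_module_closed bij_betw_def inj_on_def)

text \<open>The isometry is the reflection in the vector \<open>a - b\<close>, on which the quadratic form takes the
  unit value \<open>-\<langle>a, b\<rangle>\<close>.\<close>

lemma reflection_isometry:
  assumes a: "a \<in> carrier (free_module R (2 * n))" and b: "b \<in> carrier (free_module R (2 * n))"
    and qa: "hyperbolic_form R n a = \<zero>" and qb: "hyperbolic_form R n b = \<zero>"
    and u: "polar_form R n a b \<in> Units R"
  obtains g where "g \<in> isometries R n" "g a = b"
    "\<And>c. c \<in> carrier (free_module R (2 * n)) \<Longrightarrow> polar_form R n c a = polar_form R n c b \<Longrightarrow> g c = c"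
proof -
  let ?M = "free_module R (2 * n)" and ?B = "polar_form R n" and ?Q = "hyperbolic_form R n"
  \<comment> \<open>With \<open>w = a - b\<close> the computation below gives
    \<open>Q(w) = - B(a, b)\<close>, so \<open>\<gamma> = - 1 / Q(w)\<close> and \<open>g\<close> is
    the usual reflection \<open>z - (B(z, w) / Q(w)) w\<close>.\<close>
  define \<gamma> where "\<gamma> = inv (?B a b)"
  define w where "w = a \<oplus>\<^bsub>?M\<^esub> (\<ominus> \<one>) \<odot>\<^bsub>?M\<^esub> b"
  define g where "g = (\<lambda>z\<in>carrier ?M. z \<oplus>\<^bsub>?M\<^esub> (\<gamma> \<otimes> ?B z w) \<odot>\<^bsub>?M\<^esub> w)"
  have \<gamma>: "\<gamma> \<in> carrier R" "\<gamma> \<otimes> ?B a b = \<one>" using u by (simp_all add: \<gamma>_def)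
  have w: "w \<in> carrier ?M" unfolding w_def using a b by (intro free_module_closed) auto
  have Bw: "?B z w = ?B z a \<ominus> ?B z b" if z: "z \<in> carrier ?M" for z
  proof -
    have "?B z w = ?B z a \<oplus> (\<ominus> \<one>) \<otimes> ?B z b"
      unfolding w_def using a b z by (subst polar_form_add) (auto simp: polar_form_smult free_module_closed)
    then show ?thesis using a b z by (simp add: l_minus minus_eq)
  qed
  have Qw: "?Q w = \<ominus> ?B a b"
  proof -
    have "?Q w = ?Q a \<oplus> (\<ominus> \<one>) \<otimes> (\<ominus> \<one>) \<otimes> ?Q b \<oplus> (\<ominus> \<one>) \<otimes> ?B a b"
      unfolding w_def using a b
      by (subst hyperbolic_form_add) (auto simp: polar_form_smult hyperbolic_form_smult free_module_closed)
    then show ?thesis using a b by (simp add: qa qb l_minus)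
  qed
  \<comment> \<open>This is \<open>B(w, w) = 2 Q(w)\<close> after scaling; it makes \<open>g\<close>
    negate the pairing with \<open>w\<close> and hence makes \<open>g\<close> an involution.\<close>
  have Bww: "\<gamma> \<otimes> ?B w w = \<ominus> \<one> \<ominus> \<one>"
  proof -
    have "\<gamma> \<otimes> (\<ominus> t \<oplus> \<ominus> t) = \<ominus> (\<gamma> \<otimes> t) \<ominus> (\<gamma> \<otimes> t)" if "t \<in> carrier R" for t
      using that \<gamma>(1) by (simp add: r_distr r_minus minus_eq)
    then show ?thesis unfolding polar_form_self[OF w] Qw using a b \<gamma> by simp
  qed
  have gz: "g z = z \<oplus>\<^bsub>?M\<^esub> (\<gamma> \<otimes> ?B z w) \<odot>\<^bsub>?M\<^esub> w" if "z \<in> carrier ?M" for z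
    using that by (simp add: g_def)
  have gc: "g z \<in> carrier ?M" if "z \<in> carrier ?M" for z
    unfolding gz[OF that] using that w \<gamma> by (intro free_module_closed) auto
  have gcoord: "g z i = z i \<oplus> \<gamma> \<otimes> ?B z w \<otimes> w i" if "z \<in> carrier ?M" "i < 2 * n" for z i
    unfolding gz[OF that(1)] using that by (simp add: free_module_sel)
  have eqI: "x = y" if "x \<in> carrier ?M" "y \<in> carrier ?M" "\<And>i. i < 2 * n \<Longrightarrow> x i = y i" for x y
    using that by (intro vec_eqI) (auto simp: free_module_sel)
  have coord: "x i \<in> carrier R" if "x \<in> carrier ?M" "i < 2 * n" for x i
    using that by (auto simp: free_module_sel)
  have hom: "g \<in> module_hom R ?M ?M"
  proof (rule module_homI)
    show "g \<in> extensional (carrier ?M)" by (simp add: g_def)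
    fix x assume x: "x \<in> carrier ?M"
    then show "g x \<in> carrier ?M" by (rule gc)
    {
      fix y assume y: "y \<in> carrier ?M"
      have xy: "x \<oplus>\<^bsub>?M\<^esub> y \<in> carrier ?M" using x y by (rule free_module_closed)
      have B: "?B (x \<oplus>\<^bsub>?M\<^esub> y) w = ?B x w \<oplus> ?B y w"
        using x y w xy by (simp add: polar_form_commute[of _ _ w] polar_form_add)
      show "g (x \<oplus>\<^bsub>?M\<^esub> y) = g x \<oplus>\<^bsub>?M\<^esub> g y"
      proof (rule eqI)
        fix i assume i: "i < 2 * n"
        have id: "x' \<oplus> y' \<oplus> \<gamma> \<otimes> (r \<oplus> s) \<otimes> w' = (x' \<oplus> \<gamma> \<otimes> r \<otimes> w') \<oplus> (y' \<oplus> \<gamma> \<otimes> s \<otimes> w')"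
          if "x' \<in> carrier R" "y' \<in> carrier R" "r \<in> carrier R" "s \<in> carrier R" "w' \<in> carrier R"
          for x' y' r s w'
          using that \<gamma>(1) by (simp add: l_distr r_distr m_ac a_ac)
        have "g (x \<oplus>\<^bsub>?M\<^esub> y) i = x i \<oplus> y i \<oplus> \<gamma> \<otimes> (?B x w \<oplus> ?B y w) \<otimes> w i"
          unfolding gcoord[OF xy i] B using i by (simp add: free_module_sel)
        also have "\<dots> = g x i \<oplus> g y i"
          unfolding gcoord[OF x i] gcoord[OF y i]
          by (rule id) (use x y w i in \<open>simp_all add: coord\<close>)
        finally show "g (x \<oplus>\<^bsub>?M\<^esub> y) i = (g x \<oplus>\<^bsub>?M\<^esub> g y) i" using i by (simp add: free_module_sel)
      qed (use x y xy gc free_module_closed in blast)+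
    }
    {
      fix r assume r: "r \<in> carrier R"
      have rx: "r \<odot>\<^bsub>?M\<^esub> x \<in> carrier ?M" using r x by (rule free_module_closed)
      have B: "?B (r \<odot>\<^bsub>?M\<^esub> x) w = r \<otimes> ?B x w"
        using x r w rx by (simp add: polar_form_commute[of _ _ w] polar_form_smult)
      show "g (r \<odot>\<^bsub>?M\<^esub> x) = r \<odot>\<^bsub>?M\<^esub> g x"
      proof (rule eqI)
        fix i assume i: "i < 2 * n"
        have id: "r \<otimes> x' \<oplus> \<gamma> \<otimes> (r \<otimes> s) \<otimes> w' = r \<otimes> (x' \<oplus> \<gamma> \<otimes> s \<otimes> w')"
          if "x' \<in> carrier R" "s \<in> carrier R" "w' \<in> carrier R" for x' s w'
          using that \<gamma>(1) r by (simp add: r_distr m_ac)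
        have "g (r \<odot>\<^bsub>?M\<^esub> x) i = r \<otimes> x i \<oplus> \<gamma> \<otimes> (r \<otimes> ?B x w) \<otimes> w i"
          unfolding gcoord[OF rx i] B using i by (simp add: free_module_sel)
        also have "\<dots> = r \<otimes> g x i"
          unfolding gcoord[OF x i] by (rule id) (use x w i in \<open>simp_all add: coord\<close>)
        finally show "g (r \<odot>\<^bsub>?M\<^esub> x) i = (r \<odot>\<^bsub>?M\<^esub> g x) i" using i by (simp add: free_module_sel)
      qed (use x r rx gc free_module_closed in blast)+
    }
  qed
  have inv: "g (g z) = z" if z: "z \<in> carrier ?M" for z
  proof (rule eqI[OF gc[OF gc[OF z]] z])
    fix i assume i: "i < 2 * n"
    have sc: "(\<gamma> \<otimes> ?B z w) \<odot>\<^bsub>?M\<^esub> w \<in> carrier ?M" using z w \<gamma> by (intro free_module_closed) auto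
    have "?B w (g z) = ?B w z \<oplus> (\<gamma> \<otimes> ?B z w) \<otimes> ?B w w"
      unfolding gz[OF z] using z w sc \<gamma> by (simp add: polar_form_add polar_form_smult)
    then have "?B (g z) w = ?B z w \<oplus> (\<gamma> \<otimes> ?B z w) \<otimes> ?B w w"
      by (simp only: polar_form_commute[OF gc[OF z] w] polar_form_commute[OF w z])
    moreover have "s \<oplus> (\<gamma> \<otimes> s) \<otimes> t = s \<oplus> s \<otimes> (\<gamma> \<otimes> t)" if "s \<in> carrier R" "t \<in> carrier R" for s t
      using that \<gamma>(1) by (simp add: m_ac)
    ultimately have "?B (g z) w = ?B z w \<oplus> ?B z w \<otimes> (\<ominus> \<one> \<ominus> \<one>)"
      using z w by (simp add: Bww)
    moreover have "s \<oplus> s \<otimes> (\<ominus> \<one> \<ominus> \<one>) = \<ominus> s" if "s \<in> carrier R" for s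
      using that by (simp add: minus_eq r_distr r_minus r_neg2)
    ultimately have B: "?B (g z) w = \<ominus> ?B z w" using z w by simp
    have id: "z' \<oplus> \<gamma> \<otimes> s \<otimes> w' \<oplus> \<gamma> \<otimes> (\<ominus> s) \<otimes> w' = z'"
      if "z' \<in> carrier R" "s \<in> carrier R" "w' \<in> carrier R" for z' s w'
      using that \<gamma>(1) by (simp add: l_minus r_minus a_assoc r_neg)
    show "g (g z) i = z i"
      unfolding gcoord[OF gc[OF z] i] B unfolding gcoord[OF z i]
      by (rule id) (use z w i in \<open>simp_all add: coord\<close>)
  qed
  have bij: "bij_betw g (carrier ?M) (carrier ?M)"
    by (rule bij_betw_byWitness[of _ g]) (use inv gc in auto)
  \<comment> \<open>The two correction terms in \<open>Q(z + \<gamma> B(z, w) w)\<close> add up to a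
    multiple of \<open>\<gamma> Q(w) + 1\<close>, which vanishes.\<close>
  have "?Q (g z) = ?Q z" if z: "z \<in> carrier ?M" for z
  proof -
    have sc: "(\<gamma> \<otimes> ?B z w) \<odot>\<^bsub>?M\<^esub> w \<in> carrier ?M" using z w \<gamma> by (intro free_module_closed) auto
    have c: "\<gamma> \<otimes> ?B z w \<in> carrier R" using z w \<gamma> by simp
    have "?Q (g z) = ?Q z \<oplus> (\<gamma> \<otimes> ?B z w) \<otimes> (\<gamma> \<otimes> ?B z w) \<otimes> (\<ominus> ?B a b)
        \<oplus> (\<gamma> \<otimes> ?B z w) \<otimes> ?B z w"
      unfolding gz[OF z] hyperbolic_form_add[OF z sc] hyperbolic_form_smult[OF w c]
        polar_form_smult[OF w z c] Qw ..
    moreover have "q \<oplus> (\<gamma> \<otimes> s) \<otimes> (\<gamma> \<otimes> s) \<otimes> (\<ominus> t) \<oplus> (\<gamma> \<otimes> s) \<otimes> s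
        = q \<oplus> \<gamma> \<otimes> s \<otimes> s \<otimes> (\<one> \<ominus> \<gamma> \<otimes> t)"
      if "q \<in> carrier R" "s \<in> carrier R" "t \<in> carrier R" for q s t
      using that \<gamma>(1) by (simp add: minus_eq r_distr r_minus m_ac a_ac)
    ultimately have "?Q (g z) = ?Q z \<oplus> \<gamma> \<otimes> ?B z w \<otimes> ?B z w \<otimes> (\<one> \<ominus> \<gamma> \<otimes> ?B a b)"
      using z w a b by simp
    then show ?thesis using z w \<gamma> by (simp add: minus_eq r_neg)
  qed
  with hom bij have "g \<in> isometries R n" by (simp add: isometries_def)
  \<comment> \<open>As \<open>a\<close> is isotropic, \<open>B(a, w) = - B(a, b)\<close>; hence
    \<open>\<gamma> B(a, w) = - 1\<close> and \<open>g a = a - w\<close>.\<close>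
  moreover have "g a = b"
  proof (rule eqI[OF gc[OF a] b])
    fix i assume i: "i < 2 * n"
    have "?B a w = \<ominus> ?B a b"
      unfolding Bw[OF a] polar_form_self[OF a] using a b by (simp add: qa minus_eq)
    then have "\<gamma> \<otimes> ?B a w = \<ominus> \<one>" using \<gamma> a b by (simp add: r_minus)
    moreover have "w i = a i \<ominus> b i"
      unfolding w_def using a b i by (simp add: free_module_sel coord l_minus minus_eq PiE_mem)
    moreover have "a' \<oplus> (\<ominus> \<one>) \<otimes> (a' \<ominus> b') = b'" if "a' \<in> carrier R" "b' \<in> carrier R" for a' b'
      using that by (simp add: minus_eq l_minus minus_add r_neg2)
    ultimately show "g a i = b i"
      unfolding gcoord[OF a i] using a b i by (simp add: coord)
  qed
  moreover have "g c = c" if c: "c \<in> carrier ?M" and e: "?B c a = ?B c b" for c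
  proof (rule eqI[OF gc[OF c] c])
    fix i assume i: "i < 2 * n"
    have "?B c w = \<zero>" unfolding Bw[OF c] e using b c by (simp add: minus_eq r_neg)
    then show "g c i = c i" unfolding gcoord[OF c i] using \<gamma> coord[OF w i] coord[OF c i] by simp
  qed
  ultimately show thesis by (rule that)
qed

end

section \<open>Transitivity of the isometries on isotropic injections\<close>

definition isotropic_injections ::
  "('a, 'r) ring_scheme \<Rightarrow> nat \<Rightarrow> nat \<Rightarrow> ((nat \<Rightarrow> 'a) \<Rightarrow> nat \<Rightarrow> 'a) set" where
  "isotropic_injections R m n = {f \<in> module_hom R (free_module R m) (free_module R (2 * n)).
     inj_on f (carrier (free_module R m)) \<and>
     (\<forall>x\<in>carrier (free_module R m). hyperbolic_form R n (f x) = \<zero>\<^bsub>R\<^esub>)}"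

text \<open>Every finite local ring has such an element \<open>s\<close> (in its socle); conversely the condition
  forces the ring to be local.\<close>

locale socle_cring = cring R for R (structure) +
  fixes s
  assumes finite_carrier: "finite (carrier R)"
    and s_closed [simp]: "s \<in> carrier R"
    and s_nonzero: "s \<noteq> \<zero>"
    and socle: "x \<in> carrier R \<Longrightarrow> x \<notin> Units R \<Longrightarrow> s \<otimes> x = \<zero>"

context cring
begin

text \<open>Covers both the projection of \<open>R^m\<close> to its first \<open>j\<close>
  coordinates and the embedding of these coordinates into a module of another rank.\<close>

lemma truncation_hom:
  assumes j: "j \<le> m"
  shows "(\<lambda>x\<in>carrier (free_module R m). \<lambda>l\<in>{..<k}. if l < j then x l else \<zero>)
    \<in> module_hom R (free_module R m) (free_module R k)" (is "?t \<in> _")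
proof (rule module_homI)
  let ?L = "free_module R m"
  show "?t \<in> extensional (carrier ?L)" by simp
  fix x assume x: "x \<in> carrier ?L"
  have xl: "x l \<in> carrier R" if "l < j" for l
    using PiE_mem[of x "{..<m}" "\<lambda>_. carrier R" l] x that j by (simp add: free_module_sel(1))
  show "?t x \<in> carrier (free_module R k)"
    using x xl by (auto simp: free_module_sel(1))
  {
    fix y assume y: "y \<in> carrier ?L"
    have xy: "x \<oplus>\<^bsub>?L\<^esub> y \<in> carrier ?L" using x y by (rule free_module_closed)
    show "?t (x \<oplus>\<^bsub>?L\<^esub> y) = ?t x \<oplus>\<^bsub>free_module R k\<^esub> ?t y"
      unfolding restrict_apply'[OF xy] restrict_apply'[OF x] restrict_apply'[OF y]
      using j by (auto simp: free_module_sel(3) fun_eq_iff)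
  }
  {
    fix r assume r: "r \<in> carrier R"
    have rx: "r \<odot>\<^bsub>?L\<^esub> x \<in> carrier ?L" using r x by (rule free_module_closed)
    show "?t (r \<odot>\<^bsub>?L\<^esub> x) = r \<odot>\<^bsub>free_module R k\<^esub> ?t x"
      unfolding restrict_apply'[OF rx] restrict_apply'[OF x]
      using j r by (auto simp: free_module_sel(4) fun_eq_iff)
  }
qed

lemma polar_form_isotropic_injection:
  assumes f: "f \<in> isotropic_injections R m n"
    and x: "x \<in> carrier (free_module R m)" and y: "y \<in> carrier (free_module R m)"
  shows "polar_form R n (f x) (f y) = \<zero>"
proof -
  have hom: "f \<in> module_hom R (free_module R m) (free_module R (2 * n))"
    and Q: "\<And>z. z \<in> carrier (free_module R m) \<Longrightarrow> hyperbolic_form R n (f z) = \<zero>"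
    using f by (auto simp: isotropic_injections_def)
  have c: "f x \<in> carrier (free_module R (2 * n))" "f y \<in> carrier (free_module R (2 * n))"
    using module_homD(1)[OF hom] x y by blast+
  have "\<zero> = hyperbolic_form R n (f (x \<oplus>\<^bsub>free_module R m\<^esub> y))"
    using Q[OF free_module_closed(1)[OF x y]] by simp
  also have "\<dots> = polar_form R n (f x) (f y)"
    unfolding module_homD(2)[OF hom x y] hyperbolic_form_add[OF c] using c by (simp add: Q x y)
  finally show ?thesis by simp
qed

lemma isotropic_injections_isometry:
  assumes f: "f \<in> isotropic_injections R m n" and g: "g \<in> isometries R n"
  shows "compose (carrier (free_module R m)) g f \<in> isotropic_injections R m n"
proof -
  let ?L = "free_module R m" and ?M = "free_module R (2 * n)"
  have hf: "f \<in> module_hom R ?L ?M" and inj: "inj_on f (carrier ?L)"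
    using f by (auto simp: isotropic_injections_def)
  have hg: "g \<in> module_hom R ?M ?M" and bij: "bij_betw g (carrier ?M) (carrier ?M)"
    using g by (auto simp: isometries_def)
  have "compose (carrier ?L) g f \<in> module_hom R ?L ?M"
    by (rule module_hom_compose[OF hf hg free_module_closed])
  moreover have "inj_on (compose (carrier ?L) g f) (carrier ?L)"
    by (rule inj_on_compose_hom[OF hf inj bij_betw_imp_inj_on[OF bij]])
  moreover have "hyperbolic_form R n (compose (carrier ?L) g f x) = \<zero>" if "x \<in> carrier ?L" for x
    using f g that module_homD(1)[OF hf that]
    by (simp add: compose_def isotropic_injections_def isometries_def)
  ultimately show ?thesis by (simp add: isotropic_injections_def)
qed

end

context socle_cring
begin

text \<open>Locality of the ring: \<open>s\<close> annihilates every nonunit and no unit. If the sum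
  were a nonunit, \<open>s\<close> would annihilate \<open>y\<close> as well.\<close>

lemma nonunit_add_Unit:
  assumes x: "x \<in> carrier R" "x \<notin> Units R" and y: "y \<in> Units R"
  shows "x \<oplus> y \<in> Units R"
proof (rule ccontr)
  assume "x \<oplus> y \<notin> Units R"
  then have "\<zero> = s \<otimes> (x \<oplus> y)" using socle[of "x \<oplus> y"] x y Units_closed by force
  also have "\<dots> = s \<otimes> y" using x socle[OF x] Units_closed[OF y] by (simp add: r_distr)
  finally have "s \<otimes> y = \<zero>" by simp
  then have "s \<otimes> y \<otimes> inv y = \<zero>" using Units_inv_closed[OF y] by simp
  then show False using y s_nonzero Units_closed[OF y] by (simp add: m_assoc)
qed

text \<open>Let \<open>v\<close> be the image of \<open>e_j\<close>. If all the coordinates in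
  question were nonunits, \<open>s\<close> would kill them, and \<open>s v\<close> would lie in the
  span of the first \<open>j\<close> standard vectors. That span is already the image of the first
  \<open>j\<close> coordinates of \<open>R^m\<close>, so \<open>s e_j\<close> would share its image
  with a vector whose coordinate \<open>j\<close> is zero. The resulting \<open>k\<close> also shows
  that \<open>j < n\<close>.\<close>

lemma isotropic_injection_unit_coordinate:
  assumes f: "f \<in> isotropic_injections R m n" and j: "j < m" "j \<le> n"
    and std: "\<And>i. i < j \<Longrightarrow> f (unit_vec R m i) = unit_vec R (2 * n) i"
  obtains k where "j \<le> k" "k < n"
    "f (unit_vec R m j) k \<in> Units R \<or> f (unit_vec R m j) (n + k) \<in> Units R"
proof -
  let ?L = "free_module R m" and ?M = "free_module R (2 * n)"
  define v where "v = f (unit_vec R m j)"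
  have hf: "f \<in> module_hom R ?L ?M" and inj: "inj_on f (carrier ?L)"
    using f by (auto simp: isotropic_injections_def)
  have v: "v \<in> carrier ?M" unfolding v_def by (rule module_homD(1)[OF hf unit_vec_closed])
  then have vc: "v l \<in> carrier R" if "l < 2 * n" for l using that by (auto simp: free_module_sel)
  \<comment> \<open>Isotropy of the image makes \<open>v\<close> orthogonal to the standard vector
    \<open>e_i\<close>, whose partner is coordinate \<open>n + i\<close>.\<close>
  have v0: "v (n + i) = \<zero>" if "i < j" for i
    using polar_form_isotropic_injection[OF f unit_vec_closed unit_vec_closed, of j i]
      polar_form_unit_vec[OF v, of i] that j by (simp add: std v_def)
  have "\<exists>k. j \<le> k \<and> k < n \<and> (v k \<in> Units R \<or> v (n + k) \<in> Units R)"
  proof (rule ccontr)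
    assume neg: "\<not> ?thesis"
    define p where "p = (\<lambda>x\<in>carrier ?L. \<lambda>i\<in>{..<m}. if i < j then x i else \<zero>)"
    define st where "st = (\<lambda>x\<in>carrier ?L. \<lambda>l\<in>{..<2 * n}. if l < j then x l else \<zero>)"
    \<comment> \<open>The candidate preimage of \<open>s v\<close>: its first \<open>j\<close>
      coordinates, read as a vector of \<open>R^m\<close>. The identity \<open>f o p = st\<close>
      below evaluates \<open>f\<close> at it.\<close>
    define a where "a = (\<lambda>i\<in>{..<m}. if i < j then s \<otimes> v i else \<zero>)"
    have hp: "p \<in> module_hom R ?L ?L" unfolding p_def by (rule truncation_hom) (use j in simp)
    have hst: "st \<in> module_hom R ?L ?M" unfolding st_def by (rule truncation_hom) (use j in simp)
    have a: "a \<in> carrier ?L" using j vc by (auto simp: a_def free_module_sel)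
    have "compose (carrier ?L) f p = st"
    proof (rule module_hom_eqI[OF module_hom_compose[OF hp hf free_module_closed] hst module_free_module])
      fix i assume i: "i < m"
      show "compose (carrier ?L) f p (unit_vec R m i) = st (unit_vec R m i)"
      proof (cases "i < j")
        case True
        then have "p (unit_vec R m i) = unit_vec R m i"
          by (simp add: p_def) (auto simp: unit_vec_def fun_eq_iff)
        moreover have "st (unit_vec R m i) = unit_vec R (2 * n) i"
          using True j by (simp add: st_def) (auto simp: unit_vec_def fun_eq_iff)
        ultimately show ?thesis using std[OF True] by (simp add: compose_def)
      next
        case False
        then have "p (unit_vec R m i) = \<zero>\<^bsub>?L\<^esub>"
          by (simp add: p_def) (auto simp: unit_vec_def fun_eq_iff free_module_sel)
        moreover have "st (unit_vec R m i) = \<zero>\<^bsub>?M\<^esub>"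
          using False j by (simp add: st_def) (auto simp: unit_vec_def fun_eq_iff free_module_sel)
        ultimately show ?thesis
          using module_hom_zero[OF hf module_free_module] by (simp add: compose_def)
      qed
    qed
    then have "f (p a) = st a" using a by (metis compose_eq)
    moreover have "p a = a" using a by (auto simp: p_def a_def fun_eq_iff)
    moreover have "st a = s \<odot>\<^bsub>?M\<^esub> v"
    proof (rule vec_eqI)
      show "st a \<in> {..<2 * n} \<rightarrow>\<^sub>E carrier R"
        using module_homD(1)[OF hst a] by (simp add: free_module_sel)
      show "s \<odot>\<^bsub>?M\<^esub> v \<in> {..<2 * n} \<rightarrow>\<^sub>E carrier R"
        using free_module_closed(2)[OF s_closed v] by (simp add: free_module_sel)
      fix l assume l: "l < 2 * n"
      \<comment> \<open>Coordinates from \<open>n\<close> to \<open>n + j - 1\<close> vanish by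
        isotropy; every other one beyond \<open>j\<close> is a nonunit by the assumption
        \<open>neg\<close>.\<close>
      have "s \<otimes> v l = \<zero>" if "j \<le> l"
      proof (cases "l < n + j \<and> n \<le> l")
        case True
        then have "l - n < j" "n + (l - n) = l" by auto
        then show ?thesis using v0[of "l - n"] by simp
      next
        case False
        define k where "k = (if l < n then l else l - n)"
        have "j \<le> k \<and> k < n" "l = k \<or> l = n + k" using False that l by (auto simp: k_def)
        then have "v l \<notin> Units R" using neg by blast
        then show ?thesis using socle vc[OF l] by blast
      qed
      then show "st a l = (s \<odot>\<^bsub>?M\<^esub> v) l" using l j a by (simp add: st_def a_def free_module_sel)
    qed
    ultimately have "f a = f (s \<odot>\<^bsub>?L\<^esub> unit_vec R m j)"
      using module_homD(3)[OF hf s_closed unit_vec_closed] by (simp add: v_def)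
    then have "a = s \<odot>\<^bsub>?L\<^esub> unit_vec R m j"
      using inj a free_module_closed(2)[OF s_closed unit_vec_closed] by (metis inj_onD)
    then have "a j = (s \<odot>\<^bsub>?L\<^esub> unit_vec R m j) j" by simp
    \<comment> \<open>At coordinate \<open>j\<close> the vector \<open>a\<close> is zero, whereas
      \<open>s e_j\<close> has the entry \<open>s\<close>.\<close>
    then show False using j s_nonzero by (simp add: a_def free_module_sel)
  qed
  then show thesis using that by (auto simp: v_def)
qed

text \<open>A single reflection sends \<open>v\<close> to \<open>e_j\<close> if
  \<open>B(v, e_j) = v (n + j)\<close> is a unit. Otherwise the move goes through an isotropic
  \<open>w\<close> for which \<open>B(v, w)\<close> and \<open>B(w, e_j)\<close> are both units. The
  vectors \<open>v\<close>, \<open>w\<close> and \<open>e_j\<close> all vanish at the coordinates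
  \<open>n + i\<close> with \<open>i < j\<close>; their differences are therefore orthogonal to the
  earlier \<open>e_i\<close>, which the reflections fix.\<close>

lemma isotropic_vector_to_unit_vec:
  assumes v: "v \<in> carrier (free_module R (2 * n))" and Qv: "hyperbolic_form R n v = \<zero>"
    and v0: "\<And>i. i < j \<Longrightarrow> v (n + i) = \<zero>"
    and k: "j \<le> k" "k < n" "v k \<in> Units R \<or> v (n + k) \<in> Units R"
  obtains h where "h \<in> isometries R n" "h v = unit_vec R (2 * n) j"
    "\<And>i. i < j \<Longrightarrow> h (unit_vec R (2 * n) i) = unit_vec R (2 * n) i"
proof -
  let ?M = "free_module R (2 * n)" and ?E = "unit_vec R (2 * n)" and ?B = "polar_form R n"
  have vc: "v l \<in> carrier R" if "l < 2 * n" for l using v that by (auto simp: free_module_sel)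
  have refl: "\<exists>h\<in>isometries R n. h x = y \<and> (\<forall>i<j. h (?E i) = ?E i)"
    if x: "x \<in> carrier ?M" "hyperbolic_form R n x = \<zero>" "\<And>i. i < j \<Longrightarrow> x (n + i) = \<zero>"
      and y: "y \<in> carrier ?M" "hyperbolic_form R n y = \<zero>" "\<And>i. i < j \<Longrightarrow> y (n + i) = \<zero>"
      and u: "?B x y \<in> Units R" for x y
  proof -
    obtain h where h: "h \<in> isometries R n" "h x = y"
      "\<And>c. c \<in> carrier ?M \<Longrightarrow> ?B c x = ?B c y \<Longrightarrow> h c = c"
      using reflection_isometry[OF x(1) y(1) x(2) y(2) u] by blast
    have "h (?E i) = ?E i" if "i < j" for i
    proof (rule h(3)[OF unit_vec_closed])
      show "?B (?E i) x = ?B (?E i) y"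
        unfolding polar_form_commute[OF unit_vec_closed x(1)] polar_form_commute[OF unit_vec_closed y(1)]
        using polar_form_unit_vec[OF x(1), of i] polar_form_unit_vec[OF y(1), of i] x(3) y(3) that k
        by simp
    qed
    with h show ?thesis by blast
  qed
  have "\<exists>h\<in>isometries R n. h v = ?E j \<and> (\<forall>i<j. h (?E i) = ?E i)"
  proof (cases "v (n + j) \<in> Units R")
    case True
    show ?thesis
      by (rule refl[OF v Qv v0 unit_vec_closed])
        (use True k polar_form_unit_vec[OF v, of j] in \<open>auto simp: hyperbolic_form_unit_vec\<close>)
  next
    case False
    have "\<exists>w\<in>carrier ?M. hyperbolic_form R n w = \<zero> \<and> (\<forall>i<j. w (n + i) = \<zero>) \<and> w (n + j) = \<one>
        \<and> ?B v w \<in> Units R"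
    proof (cases "v j \<in> Units R")
      case True
      show ?thesis
        by (rule bexI[of _ "?E (n + j)"])
          (use True k polar_form_unit_vec[OF v, of "n + j"] in \<open>auto simp: hyperbolic_form_unit_vec\<close>)
    next
      case nu: False
      then have jk: "j < k" using False k by (metis le_neq_implies_less)
      \<comment> \<open>The hyperbolic partner of a unit coordinate of \<open>v\<close>. For
        \<open>w = e_(n + j) + e_l\<close> the pairing with \<open>v\<close> is the nonunit
        \<open>v j\<close> plus a unit, hence a unit. Since \<open>k \<noteq> j\<close>, the two
        summands are orthogonal, so \<open>w\<close> is isotropic.\<close>
      define l where "l = (if v k \<in> Units R then n + k else k)"
      have l: "l < 2 * n" "l \<noteq> j" "l \<noteq> n + j" "\<And>i. i < j \<Longrightarrow> l \<noteq> n + i"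
        "l - n \<noteq> n + j" using k jk by (auto simp: l_def)
      have vl: "v (if l < n then n + l else l - n) \<in> Units R" using k by (auto simp: l_def)
      let ?w = "?E (n + j) \<oplus>\<^bsub>?M\<^esub> ?E l"
      have "?B v ?w = v j \<oplus> v (if l < n then n + l else l - n)"
        using k by (simp add: polar_form_add v polar_form_unit_vec l)
      then have "?B v ?w \<in> Units R"
        using nonunit_add_Unit[OF vc nu vl] k by simp
      moreover have "hyperbolic_form R n ?w = \<zero>"
      proof -
        have "?B (?E (n + j)) (?E l) = \<zero>"
          using polar_form_unit_vec[OF unit_vec_closed l(1), of "n + j"] l k by auto
        then show ?thesis
          using k l(1) by (simp add: hyperbolic_form_add hyperbolic_form_unit_vec)
      qed
      moreover have "?w (n + i) = \<zero>" if "i < j" for i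
        using k l(3) l(4)[OF that] that jk by (simp_all add: free_module_sel(3))
      moreover have "?w (n + j) = \<one>"
        using k l(3) jk by (simp add: free_module_sel(3))
      moreover have "?w \<in> carrier ?M" by (rule free_module_closed(1)[OF unit_vec_closed unit_vec_closed])
      ultimately show ?thesis by blast
    qed
    then obtain w where w: "w \<in> carrier ?M" "hyperbolic_form R n w = \<zero>"
      "\<And>i. i < j \<Longrightarrow> w (n + i) = \<zero>" "w (n + j) = \<one>" "?B v w \<in> Units R" by blast
    obtain h1 where h1: "h1 \<in> isometries R n" "h1 v = w" "\<And>i. i < j \<Longrightarrow> h1 (?E i) = ?E i"
      using refl[OF v Qv v0 w(1-3,5)] by blast
    have "\<exists>h\<in>isometries R n. h w = ?E j \<and> (\<forall>i<j. h (?E i) = ?E i)"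
      by (rule refl[OF w(1-3) unit_vec_closed])
        (use k w(4) polar_form_unit_vec[OF w(1), of j] in \<open>auto simp: hyperbolic_form_unit_vec\<close>)
    then obtain h2 where h2: "h2 \<in> isometries R n" "h2 w = ?E j" "\<And>i. i < j \<Longrightarrow> h2 (?E i) = ?E i"
      by blast
    show ?thesis
      by (rule bexI[OF _ isometries_compose[OF h1(1) h2(1)]])
        (use v h1 h2 in \<open>auto simp: compose_def\<close>)
  qed
  then show thesis using that by blast
qed

text \<open>A form of Witt's theorem: isometries act transitively on injective isotropic maps.\<close>

lemma isotropic_injection_standard:
  assumes f: "f \<in> isotropic_injections R m n"
  obtains g where "g \<in> isometries R n" "\<And>i. i < m \<Longrightarrow> g (f (unit_vec R m i)) = unit_vec R (2 * n) i"
proof -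
  let ?L = "free_module R m" and ?M = "free_module R (2 * n)"
  have hf: "f \<in> module_hom R ?L ?M" using f by (auto simp: isotropic_injections_def)
  \<comment> \<open>The bound by \<open>n\<close> is part of the induction because the targets must
    lie among the first \<open>n\<close> standard vectors, whose span is isotropic. In each step it
    comes from the index \<open>k\<close> with \<open>j \<le> k < n\<close>.\<close>
  have "j \<le> m \<Longrightarrow> j \<le> n \<and>
    (\<exists>g\<in>isometries R n. \<forall>i<j. g (f (unit_vec R m i)) = unit_vec R (2 * n) i)" for j
  proof (induction j)
    case 0
    then show ?case using restrict_id_isometry by auto
  next
    case (Suc j)
    then obtain g where jn: "j \<le> n" and g: "g \<in> isometries R n"
      "\<And>i. i < j \<Longrightarrow> g (f (unit_vec R m i)) = unit_vec R (2 * n) i"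
      by auto
    define f' where "f' = compose (carrier ?L) g f"
    have f': "f' \<in> isotropic_injections R m n"
      unfolding f'_def by (rule isotropic_injections_isometry[OF f g(1)])
    have std: "f' (unit_vec R m i) = unit_vec R (2 * n) i" if "i < j" for i
      using g(2)[OF that] by (simp add: f'_def compose_def)
    define v where "v = f' (unit_vec R m j)"
    obtain k where k: "j \<le> k" "k < n" "v k \<in> Units R \<or> v (n + k) \<in> Units R"
      using isotropic_injection_unit_coordinate[OF f' _ jn std, of thesis] Suc.prems
      unfolding v_def by simp
    have v: "v \<in> carrier ?M" "hyperbolic_form R n v = \<zero>"
      using f' module_homD(1)[of f' R ?L ?M, OF _ unit_vec_closed]
      by (auto simp: v_def isotropic_injections_def)
    have v0: "v (n + i) = \<zero>" if "i < j" for i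
      using polar_form_isotropic_injection[OF f' unit_vec_closed unit_vec_closed, of j i]
        polar_form_unit_vec[OF v(1), of i] that jn by (simp add: std v_def)
    obtain h where h: "h \<in> isometries R n" "h v = unit_vec R (2 * n) j"
      "\<And>i. i < j \<Longrightarrow> h (unit_vec R (2 * n) i) = unit_vec R (2 * n) i"
      using isotropic_vector_to_unit_vec[OF v v0 k] by blast
    have "compose (carrier ?M) h g (f (unit_vec R m i)) = unit_vec R (2 * n) i" if "i < Suc j" for i
    proof -
      have "compose (carrier ?M) h g (f (unit_vec R m i)) = h (f' (unit_vec R m i))"
        using module_homD(1)[OF hf unit_vec_closed] by (simp add: f'_def compose_def)
      also have "\<dots> = unit_vec R (2 * n) i"
        using that h std by (cases "i = j") (auto simp: v_def)
      finally show ?thesis .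
    qed
    then show ?case using isometries_compose[OF g(1) h(1)] k by auto
  qed
  from this[of m] obtain g where "g \<in> isometries R n"
    "\<And>i. i < m \<Longrightarrow> g (f (unit_vec R m i)) = unit_vec R (2 * n) i"
    by auto
  then show thesis by (rule that)
qed

end

section \<open>Double counting on the Grassmannian\<close>

lemma (in module) submodule_hom_image:
  assumes N: "module R N" and g: "g \<in> module_hom R M N" and Z: "submodule Z R M"
  shows "submodule (g ` Z) R N"
proof -
  interpret N: module R N by fact
  note E = submoduleE[OF Z]
  have Zc: "x \<in> carrier M" if "x \<in> Z" for x using E(1) that by blast
  have "g \<zero>\<^bsub>M\<^esub> = g (\<zero> \<odot>\<^bsub>M\<^esub> \<zero>\<^bsub>M\<^esub>)" by (simp add: smult_l_null)
  also have "\<dots> = \<zero>\<^bsub>N\<^esub>"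
    unfolding module_homD(3)[OF g R.zero_closed M.zero_closed]
    by (rule N.smult_l_null[OF module_homD(1)[OF g M.zero_closed]])
  finally have g0: "g \<zero>\<^bsub>M\<^esub> = \<zero>\<^bsub>N\<^esub>" .
  have z: "\<zero>\<^bsub>M\<^esub> \<in> Z" using subgroup.one_closed[OF submodule.axioms(1)[OF Z]] by simp
  show ?thesis
  proof (rule N.submoduleI)
    show "g ` Z \<subseteq> carrier N" using module_homD(1)[OF g] Zc by blast
    show "\<zero>\<^bsub>N\<^esub> \<in> g ` Z" using z g0 by (metis image_eqI)
  next
    fix y assume "y \<in> g ` Z"
    then obtain x where x: "x \<in> Z" "y = g x" by blast
    have "\<ominus>\<^bsub>N\<^esub> y = (\<ominus> \<one>) \<odot>\<^bsub>N\<^esub> y"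
      using module_homD(1)[OF g Zc[OF x(1)]] x(2) N.smult_l_minus[of "\<one>" y] by simp
    also have "\<dots> = g ((\<ominus> \<one>) \<odot>\<^bsub>M\<^esub> x)"
      using module_homD(3)[OF g _ Zc[OF x(1)], of "\<ominus> \<one>"] x by simp
    finally show "\<ominus>\<^bsub>N\<^esub> y \<in> g ` Z" using E(4)[of "\<ominus> \<one>" x] x by simp
  next
    fix x y assume "x \<in> g ` Z" "y \<in> g ` Z"
    then obtain u v where "u \<in> Z" "x = g u" "v \<in> Z" "y = g v" by blast
    then show "x \<oplus>\<^bsub>N\<^esub> y \<in> g ` Z"
      using module_homD(2)[OF g Zc Zc, of u v] E(5)[of u v] by (metis image_eqI)
  next
    fix a x assume "a \<in> carrier R" "x \<in> g ` Z"
    then obtain u where "u \<in> Z" "x = g u" by blast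
    then show "a \<odot>\<^bsub>N\<^esub> x \<in> g ` Z"
      using module_homD(3)[OF g \<open>a \<in> carrier R\<close> Zc, of u] E(4)[OF \<open>a \<in> carrier R\<close>, of u]
      by (metis image_eqI)
  qed
qed

lemma module_hom_restrict_carrier:
  assumes "Z \<subseteq> carrier M"
  shows "f \<in> module_hom R L (M\<lparr>carrier := Z\<rparr>) \<longleftrightarrow> f \<in> module_hom R L M \<and> f ` carrier L \<subseteq> Z"
  using assms unfolding module_hom_def PiE_def by auto

text \<open>Maps into \<open>Z \<inter> W\<close> are regarded as maps into the ambient module, so
  that one fixed set of maps serves all pairs \<open>(Z, W)\<close> in the double count.\<close>

lemma num_injective_homs_restrict_carrier:
  assumes "Z \<subseteq> carrier M"
  shows "num_injective_homs R m (M\<lparr>carrier := Z\<rparr>) =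
    card {f \<in> module_hom R (free_module R m) M. inj_on f (carrier (free_module R m)) \<and>
      f ` carrier (free_module R m) \<subseteq> Z}"
  unfolding num_injective_homs_def module_hom_restrict_carrier[OF assms]
  by (rule arg_cong[where f = card]) blast

lemma OGrD:
  assumes "Z \<in> OGr R n"
  shows "submodule Z R (free_module R (2 * n))"
    "free_of_rank R ((free_module R (2 * n))\<lparr>carrier := Z\<rparr>) n"
    "\<And>v. v \<in> Z \<Longrightarrow> hyperbolic_form R n v = \<zero>\<^bsub>R\<^esub>"
  using assms by (auto simp: OGr_def direct_summand_def)

context cring
begin

lemma OGr_subset: "Z \<in> OGr R n \<Longrightarrow> Z \<subseteq> carrier (free_module R (2 * n))"
  using module.submoduleE(1)[OF module_free_module OGrD(1)] .

text \<open>Composition with a basis isomorphism and its inverse. It makes every member of the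
  Grassmannian contribute the same number.\<close>

lemma num_injective_homs_free_of_rank:
  assumes N: "module R N" and free: "free_of_rank R N k"
  shows "num_injective_homs R m N = num_injective_homs R m (free_module R k)"
proof -
  let ?L = "free_module R m" and ?K = "free_module R k"
  interpret N: module R N by fact
  interpret K: module R ?K by (rule module_free_module)
  obtain \<phi> where \<phi>: "\<phi> \<in> module_hom R ?K N" and bij: "bij_betw \<phi> (carrier ?K) (carrier N)"
    using free by (auto simp: free_of_rank_def)
  define \<psi> where "\<psi> = restrict (inv_into (carrier ?K) \<phi>) (carrier N)"
  have \<psi>c: "\<psi> y \<in> carrier ?K" and \<phi>\<psi>: "\<phi> (\<psi> y) = y" if "y \<in> carrier N" for y
    using bij that by (auto simp: \<psi>_def bij_betw_def inv_into_into f_inv_into_f)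
  have \<psi>\<phi>: "\<psi> (\<phi> x) = x" if "x \<in> carrier ?K" for x
    using bij that module_homD(1)[OF \<phi> that] by (simp add: \<psi>_def bij_betw_def)
  have \<psi>: "\<psi> \<in> module_hom R N ?K"
  proof (rule module_homI)
    show "\<psi> \<in> extensional (carrier N)" by (simp add: \<psi>_def)
    fix x assume x: "x \<in> carrier N"
    show "\<psi> x \<in> carrier ?K" using x by (rule \<psi>c)
    show "\<psi> (x \<oplus>\<^bsub>N\<^esub> y) = \<psi> x \<oplus>\<^bsub>?K\<^esub> \<psi> y" if y: "y \<in> carrier N" for y
      using \<psi>\<phi>[OF free_module_closed(1)[OF \<psi>c[OF x] \<psi>c[OF y]]]
        module_homD(2)[OF \<phi> \<psi>c[OF x] \<psi>c[OF y]] by (simp only: \<phi>\<psi> x y)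
    show "\<psi> (r \<odot>\<^bsub>N\<^esub> x) = r \<odot>\<^bsub>?K\<^esub> \<psi> x" if r: "r \<in> carrier R" for r
      using \<psi>\<phi>[OF free_module_closed(2)[OF r \<psi>c[OF x]]]
        module_homD(3)[OF \<phi> r \<psi>c[OF x]] by (simp only: \<phi>\<psi> x)
  qed
  have inj: "inj_on \<phi> (carrier ?K)" "inj_on \<psi> (carrier N)"
    using bij inj_on_inverseI[of "carrier N" \<phi> \<psi>] \<phi>\<psi> by (auto simp: bij_betw_def)
  have "bij_betw (compose (carrier ?L) \<phi>)
      {f \<in> module_hom R ?L ?K. inj_on f (carrier ?L)} {f \<in> module_hom R ?L N. inj_on f (carrier ?L)}"
  proof (rule bij_betw_byWitness[of _ "compose (carrier ?L) \<psi>"])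
    show "\<forall>f\<in>{f \<in> module_hom R ?L ?K. inj_on f (carrier ?L)}.
        compose (carrier ?L) \<psi> (compose (carrier ?L) \<phi> f) = f"
    proof clarify
      fix f assume f: "f \<in> module_hom R ?L ?K"
      show "compose (carrier ?L) \<psi> (compose (carrier ?L) \<phi> f) = f"
        by (rule extensionalityI[OF compose_extensional module_homD(4)[OF f]])
          (simp add: compose_def \<psi>\<phi> module_homD(1)[OF f])
    qed
    show "\<forall>f\<in>{f \<in> module_hom R ?L N. inj_on f (carrier ?L)}.
        compose (carrier ?L) \<phi> (compose (carrier ?L) \<psi> f) = f"
    proof clarify
      fix f assume f: "f \<in> module_hom R ?L N"
      show "compose (carrier ?L) \<phi> (compose (carrier ?L) \<psi> f) = f"
        by (rule extensionalityI[OF compose_extensional module_homD(4)[OF f]])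
          (simp add: compose_def \<phi>\<psi> module_homD(1)[OF f])
    qed
    show "compose (carrier ?L) \<phi> ` {f \<in> module_hom R ?L ?K. inj_on f (carrier ?L)}
        \<subseteq> {f \<in> module_hom R ?L N. inj_on f (carrier ?L)}"
      using module_hom_compose[OF _ \<phi> free_module_closed] inj_on_compose_hom[OF _ _ inj(1)] by blast
    show "compose (carrier ?L) \<psi> ` {f \<in> module_hom R ?L N. inj_on f (carrier ?L)}
        \<subseteq> {f \<in> module_hom R ?L ?K. inj_on f (carrier ?L)}"
      using module_hom_compose[OF _ \<psi> free_module_closed] inj_on_compose_hom[OF _ _ inj(2)] by blast
  qed
  then show ?thesis
    unfolding num_injective_homs_def by (rule bij_betw_same_card[symmetric])
qed

lemma OGr_isometry_image:
  assumes g: "g \<in> isometries R n" and Z: "Z \<in> OGr R n"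
  shows "g ` Z \<in> OGr R n"
proof -
  let ?M = "free_module R (2 * n)" and ?K = "free_module R n"
  interpret M: module R ?M by (rule module_free_module)
  have hg: "g \<in> module_hom R ?M ?M" and bij: "bij_betw g (carrier ?M) (carrier ?M)"
    and Qg: "\<And>x. x \<in> carrier ?M \<Longrightarrow> hyperbolic_form R n (g x) = hyperbolic_form R n x"
    using g by (auto simp: isometries_def)
  have inj: "inj_on g (carrier ?M)" and surj: "g ` carrier ?M = carrier ?M"
    using bij by (auto simp: bij_betw_def)
  have Zc: "Z \<subseteq> carrier ?M" using Z by (rule OGr_subset)
  have sub: "submodule (g ` Y) R ?M" if "submodule Y R ?M" for Y
    using M.submodule_hom_image[OF module_free_module hg that] .
  obtain N where N: "submodule N R ?M" "Z \<inter> N = {\<zero>\<^bsub>?M\<^esub>}" "Z <+>\<^bsub>?M\<^esub> N = carrier ?M"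
    using Z by (auto simp: OGr_def direct_summand_def)
  have Nc: "N \<subseteq> carrier ?M" using M.submoduleE(1)[OF N(1)] .
  have "direct_summand (g ` Z) R ?M"
    unfolding direct_summand_def
  proof (intro conjI exI[of _ "g ` N"])
    show "submodule (g ` Z) R ?M" "submodule (g ` N) R ?M"
      using sub OGrD(1)[OF Z] N(1) by auto
    show "g ` Z \<inter> g ` N = {\<zero>\<^bsub>?M\<^esub>}"
      using inj_on_image_Int[OF inj Zc Nc] N(2) module_hom_zero[OF hg module_free_module] by simp
    have "g ` Z <+>\<^bsub>?M\<^esub> g ` N = g ` (Z <+>\<^bsub>?M\<^esub> N)"
    proof
      show "g ` Z <+>\<^bsub>?M\<^esub> g ` N \<subseteq> g ` (Z <+>\<^bsub>?M\<^esub> N)"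
      proof
        fix y assume "y \<in> g ` Z <+>\<^bsub>?M\<^esub> g ` N"
        then obtain u v where uv: "u \<in> Z" "v \<in> N" "y = g u \<oplus>\<^bsub>?M\<^esub> g v"
          by (auto simp: set_add_def')
        then have "y = g (u \<oplus>\<^bsub>?M\<^esub> v)" using module_homD(2)[OF hg, of u v] Zc Nc by (simp add: subset_iff)
        then show "y \<in> g ` (Z <+>\<^bsub>?M\<^esub> N)" using uv by (auto simp: set_add_def')
      qed
      show "g ` (Z <+>\<^bsub>?M\<^esub> N) \<subseteq> g ` Z <+>\<^bsub>?M\<^esub> g ` N"
      proof
        fix y assume "y \<in> g ` (Z <+>\<^bsub>?M\<^esub> N)"
        then obtain u v where uv: "u \<in> Z" "v \<in> N" "y = g (u \<oplus>\<^bsub>?M\<^esub> v)"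
          by (auto simp: set_add_def')
        then have "y = g u \<oplus>\<^bsub>?M\<^esub> g v" using module_homD(2)[OF hg, of u v] Zc Nc by (simp add: subset_iff)
        then show "y \<in> g ` Z <+>\<^bsub>?M\<^esub> g ` N" using uv by (auto simp: set_add_def')
      qed
    qed
    then show "g ` Z <+>\<^bsub>?M\<^esub> g ` N = carrier ?M" by (simp only: N(3) surj)
  qed
  moreover have "free_of_rank R (?M\<lparr>carrier := g ` Z\<rparr>) n"
  proof -
    obtain f where f: "f \<in> module_hom R ?K (?M\<lparr>carrier := Z\<rparr>)" "bij_betw f (carrier ?K) Z"
      using OGrD(2)[OF Z] by (auto simp: free_of_rank_def)
    have hf: "f \<in> module_hom R ?K ?M" using f(1) by (simp only: module_hom_restrict_carrier[OF Zc])
    have b: "bij_betw (compose (carrier ?K) g f) (carrier ?K) (g ` Z)"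
      using f(2) bij_betw_subset[OF bij Zc refl] by (rule bij_betw_compose)
    moreover have "compose (carrier ?K) g f \<in> module_hom R ?K (?M\<lparr>carrier := g ` Z\<rparr>)"
      using module_hom_compose[OF hf hg free_module_closed] b surj Zc
      by (subst module_hom_restrict_carrier) (auto simp: bij_betw_def)
    ultimately show ?thesis by (auto simp: free_of_rank_def)
  qed
  moreover have "hyperbolic_form R n v = \<zero>" if "v \<in> g ` Z" for v
    using that Qg OGrD(3)[OF Z] Zc by auto
  ultimately show ?thesis by (simp add: OGr_def)
qed

lemma finite_free_module: "finite (carrier R) \<Longrightarrow> finite (carrier (free_module R k))"
  by (simp add: free_module_sel finite_PiE)

lemma finite_module_hom:
  "finite (carrier L) \<Longrightarrow> finite (carrier M) \<Longrightarrow> finite (module_hom R L M)"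
  unfolding module_hom_def by (rule finite_subset[of _ "carrier L \<rightarrow>\<^sub>E carrier M"]) (auto intro: finite_PiE)

lemma finite_OGr:
  assumes "finite (carrier R)"
  shows "finite (OGr R n)"
  using finite_free_module[OF assms] OGr_subset
  by (intro finite_subset[of "OGr R n" "Pow (carrier (free_module R (2 * n)))"]) auto

text \<open>On a finite set injectivity gives surjectivity, which replaces an argument with the
  inverse isometry.\<close>

lemma bij_betw_isometry_OGr:
  assumes fin: "finite (carrier R)" and g: "g \<in> isometries R n"
  shows "bij_betw ((`) g) (OGr R n) (OGr R n)"
proof -
  have "inj_on g (carrier (free_module R (2 * n)))"
    using g by (auto simp: isometries_def bij_betw_def)
  then have "inj_on ((`) g) (OGr R n)"
    using OGr_subset by (intro inj_on_subset[OF inj_on_image_Pow]) auto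
  moreover have "(`) g ` OGr R n = OGr R n"
    using OGr_isometry_image[OF g] by (intro endo_inj_surj finite_OGr fin calculation) auto
  ultimately show ?thesis by (simp add: bij_betw_def)
qed

text \<open>The witness is the coordinate subspace \<open>y = 0\<close>, with complement
  \<open>x = 0\<close>. The average would otherwise be a division by zero.\<close>

lemma OGr_nonempty: "OGr R n \<noteq> {}"
proof -
  let ?M = "free_module R (2 * n)" and ?K = "free_module R n"
  interpret M: module R ?M by (rule module_free_module)
  define Z where "Z = {v \<in> carrier ?M. \<forall>l<2 * n. n \<le> l \<longrightarrow> v l = \<zero>}"
  define N where "N = {v \<in> carrier ?M. \<forall>l<n. v l = \<zero>}"
  have coord: "v l \<in> carrier R" if "v \<in> carrier ?M" "l < 2 * n" for v l
    using that by (auto simp: free_module_sel)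
  have sub: "submodule {v \<in> carrier ?M. \<forall>l<2 * n. P l \<longrightarrow> v l = \<zero>} R ?M" for P
  proof (rule M.submoduleI)
    let ?S = "{v \<in> carrier ?M. \<forall>l<2 * n. P l \<longrightarrow> v l = \<zero>}"
    show "?S \<subseteq> carrier ?M" by blast
    show "\<zero>\<^bsub>?M\<^esub> \<in> ?S" using M.zero_closed by (simp add: free_module_sel(2))
    show sm: "r \<odot>\<^bsub>?M\<^esub> x \<in> ?S" if "r \<in> carrier R" "x \<in> ?S" for r x
      using that free_module_closed(2)[OF that(1), of x] by (simp add: free_module_sel(4))
    show "x \<oplus>\<^bsub>?M\<^esub> y \<in> ?S" if "x \<in> ?S" "y \<in> ?S" for x y
      using that free_module_closed(1)[of x _ y] by (simp add: free_module_sel(3))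
    show "\<ominus>\<^bsub>?M\<^esub> x \<in> ?S" if "x \<in> ?S" for x
      using sm[of "\<ominus> \<one>" x] that M.smult_l_minus[of "\<one>" x] by simp
  qed
  have Z: "submodule Z R ?M" unfolding Z_def by (rule sub)
  have "N = {v \<in> carrier ?M. \<forall>l<2 * n. l < n \<longrightarrow> v l = \<zero>}" by (auto simp: N_def)
  then have N: "submodule N R ?M" using sub by simp
  have Zc: "Z \<subseteq> carrier ?M" by (auto simp: Z_def)
  have "direct_summand Z R ?M"
    unfolding direct_summand_def
  proof (intro conjI exI[of _ N])
    show "submodule Z R ?M" "submodule N R ?M" by fact+
    show "Z \<inter> N = {\<zero>\<^bsub>?M\<^esub>}"
    proof
      show "Z \<inter> N \<subseteq> {\<zero>\<^bsub>?M\<^esub>}"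
      proof
        fix v assume v: "v \<in> Z \<inter> N"
        have "v = \<zero>\<^bsub>?M\<^esub>"
        proof (rule vec_eqI)
          show "v \<in> {..<2 * n} \<rightarrow>\<^sub>E carrier R" using v by (simp add: Z_def free_module_sel(1))
          show "\<zero>\<^bsub>?M\<^esub> \<in> {..<2 * n} \<rightarrow>\<^sub>E carrier R" using M.zero_closed by (simp only: free_module_sel(1))
          show "v l = \<zero>\<^bsub>?M\<^esub> l" if "l < 2 * n" for l
            using v that by (cases "l < n") (auto simp: Z_def N_def free_module_sel(2))
        qed
        then show "v \<in> {\<zero>\<^bsub>?M\<^esub>}" by simp
      qed
      show "{\<zero>\<^bsub>?M\<^esub>} \<subseteq> Z \<inter> N"
        using subgroup.one_closed[OF submodule.axioms(1)[OF Z]]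
          subgroup.one_closed[OF submodule.axioms(1)[OF N]] by simp
    qed
    show "Z <+>\<^bsub>?M\<^esub> N = carrier ?M"
    proof
      show "Z <+>\<^bsub>?M\<^esub> N \<subseteq> carrier ?M"
        using free_module_closed(1) by (auto simp: set_add_def' Z_def N_def)
      show "carrier ?M \<subseteq> Z <+>\<^bsub>?M\<^esub> N"
      proof
        fix v assume v: "v \<in> carrier ?M"
        define x where "x = (\<lambda>l\<in>{..<2 * n}. if l < n then v l else \<zero>)"
        define y where "y = (\<lambda>l\<in>{..<2 * n}. if l < n then \<zero> else v l)"
        have c: "x \<in> carrier ?M" "y \<in> carrier ?M"
          using coord[OF v] by (auto simp: x_def y_def free_module_sel(1))
        then have "x \<in> Z" "y \<in> N" by (auto simp: Z_def N_def x_def y_def)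
        moreover have "v = x \<oplus>\<^bsub>?M\<^esub> y"
        proof (rule vec_eqI)
          show "v \<in> {..<2 * n} \<rightarrow>\<^sub>E carrier R" using v by (simp add: free_module_sel(1))
          show "x \<oplus>\<^bsub>?M\<^esub> y \<in> {..<2 * n} \<rightarrow>\<^sub>E carrier R"
            using free_module_closed(1)[OF c] by (simp only: free_module_sel(1))
          show "v l = (x \<oplus>\<^bsub>?M\<^esub> y) l" if "l < 2 * n" for l
            using that coord[OF v] by (simp add: x_def y_def free_module_sel(3))
        qed
        ultimately show "v \<in> Z <+>\<^bsub>?M\<^esub> N" by (auto simp: set_add_def')
      qed
    qed
  qed
  moreover have "free_of_rank R (?M\<lparr>carrier := Z\<rparr>) n"
  proof -
    let ?t = "\<lambda>x\<in>carrier ?K. \<lambda>l\<in>{..<2 * n}. if l < n then x l else \<zero>"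
    have t: "?t \<in> module_hom R ?K ?M" by (rule truncation_hom) simp
    have tZ: "?t x \<in> Z" if "x \<in> carrier ?K" for x
      using module_homD(1)[OF t that] that by (auto simp: Z_def)
    have rK: "restrict v {..<n} \<in> carrier ?K" if "v \<in> Z" for v
      using that coord[of v] by (auto simp: Z_def free_module_sel(1))
    have "bij_betw ?t (carrier ?K) Z"
    proof (rule bij_betw_byWitness[of _ "\<lambda>v. restrict v {..<n}"])
      show "\<forall>x\<in>carrier ?K. restrict (?t x) {..<n} = x"
        by (auto simp: free_module_sel(1) fun_eq_iff PiE_def extensional_def)
      show "\<forall>v\<in>Z. ?t (restrict v {..<n}) = v"
      proof
        fix v assume v: "v \<in> Z"
        show "?t (restrict v {..<n}) = v"
        proof (rule vec_eqI)
          show "?t (restrict v {..<n}) \<in> {..<2 * n} \<rightarrow>\<^sub>E carrier R"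
            using module_homD(1)[OF t rK[OF v]] by (simp only: free_module_sel(1))
          show "v \<in> {..<2 * n} \<rightarrow>\<^sub>E carrier R" using v by (simp add: Z_def free_module_sel(1))
          show "?t (restrict v {..<n}) l = v l" if "l < 2 * n" for l
            using v rK[OF v] that by (simp add: Z_def)
        qed
      qed
      show "?t ` carrier ?K \<subseteq> Z" using tZ by blast
      show "(\<lambda>v. restrict v {..<n}) ` Z \<subseteq> carrier ?K" using rK by blast
    qed
    moreover have "?t \<in> module_hom R ?K (?M\<lparr>carrier := Z\<rparr>)"
      using t tZ by (subst module_hom_restrict_carrier[OF Zc]) blast
    ultimately show ?thesis unfolding free_of_rank_def by (intro bexI[of _ ?t]) simp_all
  qed
  moreover have "hyperbolic_form R n v = \<zero>" if "v \<in> Z" for v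
  proof -
    have "hyperbolic_form R n v = (\<Oplus>i\<in>{..<n}. \<zero>)"
      unfolding hyperbolic_form_def
      by (rule finsum_cong') (use that coord[of v] in \<open>auto simp: Z_def\<close>)
    then show ?thesis by simp
  qed
  ultimately have "Z \<in> OGr R n" by (simp add: OGr_def)
  then show ?thesis by blast
qed

end

section \<open>The average as a quotient of two counts of maps\<close>

context socle_cring
begin

lemma card_OGr_containing:
  assumes f: "f \<in> isotropic_injections R m n"
  shows "card {Z \<in> OGr R n. f ` carrier (free_module R m) \<subseteq> Z} =
    card {Z \<in> OGr R n. \<forall>i<m. unit_vec R (2 * n) i \<in> Z}"
proof -
  let ?L = "free_module R m" and ?M = "free_module R (2 * n)"
  have hf: "f \<in> module_hom R ?L ?M" using f by (simp add: isotropic_injections_def)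
  obtain g where g: "g \<in> isometries R n"
    and gf: "\<And>i. i < m \<Longrightarrow> g (f (unit_vec R m i)) = unit_vec R (2 * n) i"
    using isotropic_injection_standard[OF f] by blast
  have inj: "inj_on g (carrier ?M)" using g by (auto simp: isometries_def bij_betw_def)
  have *: "f ` carrier ?L \<subseteq> Z \<longleftrightarrow> (\<forall>i<m. unit_vec R (2 * n) i \<in> g ` Z)" if Z: "Z \<in> OGr R n" for Z
  proof
    assume "f ` carrier ?L \<subseteq> Z"
    then have "f (unit_vec R m i) \<in> Z" for i using unit_vec_closed by blast
    then show "\<forall>i<m. unit_vec R (2 * n) i \<in> g ` Z" using gf by (metis imageI)
  next
    assume E: "\<forall>i<m. unit_vec R (2 * n) i \<in> g ` Z"
    have "f (unit_vec R m i) \<in> Z" if "i < m" for i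
    proof -
      have "g (f (unit_vec R m i)) \<in> g ` Z" using E gf that by simp
      then show ?thesis
        using inj_on_image_mem_iff[OF inj _ OGr_subset[OF Z]] module_homD(1)[OF hf unit_vec_closed] by blast
    qed
    then show "f ` carrier ?L \<subseteq> Z"
      using module_hom_in_submodule[OF hf module_free_module OGrD(1)[OF Z]] by blast
  qed
  note b = bij_betw_isometry_OGr[OF finite_carrier g]
  have "(`) g ` {Z \<in> OGr R n. f ` carrier ?L \<subseteq> Z} =
      {Y \<in> (`) g ` OGr R n. \<forall>i<m. unit_vec R (2 * n) i \<in> Y}"
  proof (intro equalityI subsetI)
    fix Y assume "Y \<in> (`) g ` {Z \<in> OGr R n. f ` carrier ?L \<subseteq> Z}"
    then obtain Z where "Z \<in> OGr R n" "f ` carrier ?L \<subseteq> Z" "Y = g ` Z" by blast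
    then show "Y \<in> {Y \<in> (`) g ` OGr R n. \<forall>i<m. unit_vec R (2 * n) i \<in> Y}" using *[of Z] by blast
  next
    fix Y assume "Y \<in> {Y \<in> (`) g ` OGr R n. \<forall>i<m. unit_vec R (2 * n) i \<in> Y}"
    then obtain Z where "Z \<in> OGr R n" "\<forall>i<m. unit_vec R (2 * n) i \<in> g ` Z" "Y = g ` Z" by blast
    then show "Y \<in> (`) g ` {Z \<in> OGr R n. f ` carrier ?L \<subseteq> Z}" using *[of Z] by blast
  qed
  also have "(`) g ` OGr R n = OGr R n" using b by (simp add: bij_betw_def)
  finally have "bij_betw ((`) g) {Z \<in> OGr R n. f ` carrier ?L \<subseteq> Z}
      {Z \<in> OGr R n. \<forall>i<m. unit_vec R (2 * n) i \<in> Z}"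
    by (intro bij_betw_subset[OF b]) auto
  then show ?thesis by (rule bij_betw_same_card)
qed

lemma average_injective_homs_eq:
  assumes pos: "isotropic_injections R m n \<noteq> {}"
  shows "average_injective_homs R m n =
    (real (num_injective_homs R m (free_module R n)))\<^sup>2 / real (card (isotropic_injections R m n))"
proof -
  let ?L = "free_module R m" and ?M = "free_module R (2 * n)"
  let ?H = "isotropic_injections R m n" and ?O = "OGr R n"
  \<comment> \<open>A 0/1 indicator: the product for \<open>Z\<close> and \<open>W\<close> is the
    indicator of \<open>Z \<inter> W\<close>, and the square for a single \<open>Z\<close> is the
    indicator itself.\<close>
  define in' where "in' f Z = (if f ` carrier ?L \<subseteq> Z then 1 else 0 :: real)"
    for f :: "(nat \<Rightarrow> 'a) \<Rightarrow> nat \<Rightarrow> 'a" and Z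
  define c where "c = real (card {Z \<in> ?O. \<forall>i<m. unit_vec R (2 * n) i \<in> Z})"
  define I where "I = real (num_injective_homs R m (free_module R n))"
  have finH: "finite ?H"
    using finite_module_hom[OF finite_free_module[OF finite_carrier] finite_free_module[OF finite_carrier]]
    by (simp add: isotropic_injections_def)
  have finO: "finite ?O" by (rule finite_OGr[OF finite_carrier])
  have num: "real (num_injective_homs R m (?M\<lparr>carrier := Z \<inter> W\<rparr>)) = (\<Sum>f\<in>?H. in' f Z * in' f W)"
    if Z: "Z \<in> ?O" and W: "W \<in> ?O" for Z W
  proof -
    have "num_injective_homs R m (?M\<lparr>carrier := Z \<inter> W\<rparr>) =
        card {f \<in> module_hom R ?L ?M. inj_on f (carrier ?L) \<and> f ` carrier ?L \<subseteq> Z \<inter> W}"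
      by (rule num_injective_homs_restrict_carrier) (use OGr_subset[OF Z] in blast)
    \<comment> \<open>Every map into \<open>Z\<close> is isotropic, because the form vanishes on
      \<open>Z\<close>.\<close>
    also have "{f \<in> module_hom R ?L ?M. inj_on f (carrier ?L) \<and> f ` carrier ?L \<subseteq> Z \<inter> W} =
        {f \<in> ?H. f ` carrier ?L \<subseteq> Z \<inter> W}"
      using OGrD(3)[OF Z] by (auto simp: isotropic_injections_def)
    also have "real (card \<dots>) = (\<Sum>f\<in>?H. if f ` carrier ?L \<subseteq> Z \<inter> W then 1 else 0)"
      using finH by (simp add: sum.If_cases Int_def)
    also have "\<dots> = (\<Sum>f\<in>?H. in' f Z * in' f W)"
      by (rule sum.cong) (auto simp: in'_def)
    finally show ?thesis .
  qed
  have c: "(\<Sum>Z\<in>?O. in' f Z) = c" if "f \<in> ?H" for f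
  proof -
    have "(\<Sum>Z\<in>?O. in' f Z) = real (card {Z \<in> ?O. f ` carrier ?L \<subseteq> Z})"
      using finO by (simp add: in'_def sum.If_cases Int_def)
    then show ?thesis by (simp add: c_def card_OGr_containing[OF that])
  qed
  have I: "(\<Sum>f\<in>?H. in' f Z) = I" if Z: "Z \<in> ?O" for Z
  proof -
    have "module R (?M\<lparr>carrier := Z\<rparr>)"
      by (rule submodule.submodule_is_module[OF OGrD(1)[OF Z] module_free_module])
    then have "I = real (num_injective_homs R m (?M\<lparr>carrier := Z\<rparr>))"
      using num_injective_homs_free_of_rank[OF _ OGrD(2)[OF Z]] by (simp add: I_def)
    also have "\<dots> = (\<Sum>f\<in>?H. in' f Z * in' f Z)"
      using num[OF Z Z] by simp
    also have "\<dots> = (\<Sum>f\<in>?H. in' f Z)" by (rule sum.cong) (auto simp: in'_def)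
    finally show ?thesis ..
  qed
  have "real (card ?O) * I = (\<Sum>Z\<in>?O. \<Sum>f\<in>?H. in' f Z)" by (simp add: I)
  also have "\<dots> = (\<Sum>f\<in>?H. \<Sum>Z\<in>?O. in' f Z)" by (rule sum.swap)
  also have "\<dots> = real (card ?H) * c" by (simp add: c)
  finally have OI: "real (card ?O) * I = real (card ?H) * c" .
  have "(\<Sum>(Z, W)\<in>?O \<times> ?O. real (num_injective_homs R m (?M\<lparr>carrier := Z \<inter> W\<rparr>)))
      = (\<Sum>Z\<in>?O. \<Sum>W\<in>?O. \<Sum>f\<in>?H. in' f Z * in' f W)"
    unfolding sum.cartesian_product[symmetric] by (intro sum.cong refl num)
  also have "\<dots> = (\<Sum>Z\<in>?O. \<Sum>f\<in>?H. \<Sum>W\<in>?O. in' f Z * in' f W)"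
    by (intro sum.cong refl sum.swap)
  also have "\<dots> = (\<Sum>Z\<in>?O. \<Sum>f\<in>?H. in' f Z * c)"
    by (intro sum.cong refl) (simp add: sum_distrib_left[symmetric] c)
  also have "\<dots> = real (card ?O) * I * c"
    by (simp add: sum_distrib_right[symmetric] I)
  finally have S: "(\<Sum>(Z, W)\<in>?O \<times> ?O. real (num_injective_homs R m (?M\<lparr>carrier := Z \<inter> W\<rparr>)))
      = real (card ?O) * I * c" .
  have H0: "real (card ?H) > 0" using pos finH by (simp add: card_gt_0_iff)
  have O0: "real (card ?O) > 0" using OGr_nonempty finO by (simp add: card_gt_0_iff)
  have "average_injective_homs R m n = I * (c / real (card ?O))"
    unfolding average_injective_homs_def S card_cartesian_product using O0 by (simp add: field_simps)
  \<comment> \<open>The count of pairs eliminates both unknowns, \<open>c\<close> and the size of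
    the Grassmannian.\<close>
  also have "c / real (card ?O) = I / real (card ?H)"
    using OI H0 O0 by (simp add: field_simps)
  finally show ?thesis by (simp add: I_def monoid_mult_class.power2_eq_square)
qed

end

section \<open>Counting isotropic maps\<close>

text \<open>A matrix is a family of rows from \<open>R^m\<close>, since the condition that governs
  the count is one on entire rows.\<close>

definition mat_hom :: "('a, 'r) ring_scheme \<Rightarrow> nat \<Rightarrow> nat \<Rightarrow> (nat \<Rightarrow> nat \<Rightarrow> 'a) \<Rightarrow> (nat \<Rightarrow> 'a) \<Rightarrow> nat \<Rightarrow> 'a" where
  "mat_hom R m k A = (\<lambda>a\<in>carrier (free_module R m). \<lambda>l\<in>{..<k}. dot R m (A l) a)"

text \<open>The upper block \<open>A\<close> is given by rows but the lower block \<open>Y\<close>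
  by entries: rows of \<open>A\<close> are tested against basis vectors, while entries of
  \<open>Y\<close> are chosen or solved for one by one.\<close>

definition stack_rows :: "nat \<Rightarrow> nat \<Rightarrow> (nat \<Rightarrow> nat \<Rightarrow> 'a) \<Rightarrow> (nat \<times> nat \<Rightarrow> 'a) \<Rightarrow> nat \<Rightarrow> nat \<Rightarrow> 'a" where
  "stack_rows m n A Y = (\<lambda>l\<in>{..<2 * n}. if l < n then A l else (\<lambda>i\<in>{..<m}. Y (l - n, i)))"

text \<open>The entry at \<open>(i, j)\<close> of the product \<open>A^T Y\<close>.\<close>

definition gram :: "('a, 'r) ring_scheme \<Rightarrow> nat \<Rightarrow> (nat \<Rightarrow> nat \<Rightarrow> 'a) \<Rightarrow> (nat \<times> nat \<Rightarrow> 'a) \<Rightarrow> nat \<Rightarrow> nat \<Rightarrow> 'a" where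
  "gram R n A Y i j = (\<Oplus>\<^bsub>R\<^esub>k\<in>{..<n}. A k i \<otimes>\<^bsub>R\<^esub> Y (k, j))"

definition alternating_partners ::
  "('a, 'r) ring_scheme \<Rightarrow> nat \<Rightarrow> nat \<Rightarrow> (nat \<Rightarrow> nat \<Rightarrow> 'a) \<Rightarrow> (nat \<times> nat \<Rightarrow> 'a) set" where
  "alternating_partners R m n A = {Y \<in> {..<n} \<times> {..<m} \<rightarrow>\<^sub>E carrier R.
     \<forall>i<m. gram R n A Y i i = \<zero>\<^bsub>R\<^esub> \<and> (\<forall>j<i. gram R n A Y i j \<oplus>\<^bsub>R\<^esub> gram R n A Y j i = \<zero>\<^bsub>R\<^esub>)}"

context cring
begin

lemma mat_hom_hom:
  assumes A: "A \<in> {..<k} \<rightarrow>\<^sub>E carrier (free_module R m)"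
  shows "mat_hom R m k A \<in> module_hom R (free_module R m) (free_module R k)"
proof (rule module_homI)
  let ?L = "free_module R m"
  have Xl: "A l \<in> {..<m} \<rightarrow>\<^sub>E carrier R" if "l < k" for l
    using PiE_mem[OF A, of l] that by (simp add: free_module_sel(1))
  show "mat_hom R m k A \<in> extensional (carrier ?L)" by (simp add: mat_hom_def)
  fix x assume x: "x \<in> carrier ?L"
  then have x': "x \<in> {..<m} \<rightarrow>\<^sub>E carrier R" by (simp add: free_module_sel(1))
  show "mat_hom R m k A x \<in> carrier (free_module R k)"
    using x x' Xl by (simp add: mat_hom_def free_module_sel(1)[of _ k])
  show "mat_hom R m k A (x \<oplus>\<^bsub>?L\<^esub> y) = mat_hom R m k A x \<oplus>\<^bsub>free_module R k\<^esub> mat_hom R m k A y"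
    if y: "y \<in> carrier ?L" for y
  proof -
    have y': "y \<in> {..<m} \<rightarrow>\<^sub>E carrier R" using y by (simp add: free_module_sel(1))
    show ?thesis
      using x y free_module_closed(1)[OF x y] dot_add[OF Xl x' y']
      by (simp add: mat_hom_def fun_eq_iff free_module_sel(3))
  qed
  show "mat_hom R m k A (r \<odot>\<^bsub>?L\<^esub> x) = r \<odot>\<^bsub>free_module R k\<^esub> mat_hom R m k A x"
    if r: "r \<in> carrier R" for r
    using x free_module_closed(2)[OF r x] dot_smult[OF Xl x' r]
    by (simp add: mat_hom_def fun_eq_iff free_module_sel(4))
qed

lemma mat_hom_unit_vec:
  assumes A: "A \<in> {..<k} \<rightarrow>\<^sub>E carrier (free_module R m)" and "i < m" "l < k"
  shows "mat_hom R m k A (unit_vec R m i) l = A l i"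
  using PiE_mem[OF A, of l, unfolded free_module_sel(1)[of R m]] assms(2,3) by (simp add: mat_hom_def)

lemma bij_betw_mat_hom:
  "bij_betw (mat_hom R m k) ({..<k} \<rightarrow>\<^sub>E carrier (free_module R m))
    (module_hom R (free_module R m) (free_module R k))"
proof (rule bij_betw_byWitness[of _ "\<lambda>f. \<lambda>l\<in>{..<k}. \<lambda>i\<in>{..<m}. f (unit_vec R m i) l"])
  let ?X = "\<lambda>f. \<lambda>l\<in>{..<k}. \<lambda>i\<in>{..<m}. f (unit_vec R m i) l"
  have Xc: "?X f \<in> {..<k} \<rightarrow>\<^sub>E carrier (free_module R m)"
    if f: "f \<in> module_hom R (free_module R m) (free_module R k)" for f
  proof -
    have "f (unit_vec R m i) l \<in> carrier R" if "i < m" "l < k" for i l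
      using PiE_mem[of "f (unit_vec R m i)" "{..<k}" "\<lambda>_. carrier R" l]
        module_homD(1)[OF f unit_vec_closed, of i] that by (simp add: free_module_sel(1)[of R k])
    then show ?thesis by (simp add: free_module_sel(1))
  qed
  show "\<forall>A\<in>{..<k} \<rightarrow>\<^sub>E carrier (free_module R m). ?X (mat_hom R m k A) = A"
  proof
    fix A assume A: "A \<in> {..<k} \<rightarrow>\<^sub>E carrier (free_module R m)"
    show "?X (mat_hom R m k A) = A"
    proof (rule vec_eqI[OF Xc[OF mat_hom_hom[OF A]] A])
      fix l assume l: "l < k"
      have "A l \<in> {..<m} \<rightarrow>\<^sub>E carrier R" using PiE_mem[OF A, of l] l by (simp add: free_module_sel(1))
      then show "?X (mat_hom R m k A) l = A l"
        using l by (intro vec_eqI[of _ m "carrier R" _ "carrier R"])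
          (auto simp: mat_hom_unit_vec[OF A] PiE_iff)
    qed
  qed
  show "\<forall>f\<in>module_hom R (free_module R m) (free_module R k). mat_hom R m k (?X f) = f"
  proof
    fix f assume f: "f \<in> module_hom R (free_module R m) (free_module R k)"
    show "mat_hom R m k (?X f) = f"
    proof (rule module_hom_eqI[OF mat_hom_hom[OF Xc[OF f]] f module_free_module])
      fix i assume i: "i < m"
      show "mat_hom R m k (?X f) (unit_vec R m i) = f (unit_vec R m i)"
      proof (rule vec_eqI)
        show "mat_hom R m k (?X f) (unit_vec R m i) \<in> {..<k} \<rightarrow>\<^sub>E carrier R"
          using module_homD(1)[OF mat_hom_hom[OF Xc[OF f]] unit_vec_closed, of i]
          by (simp only: free_module_sel(1))
        show "f (unit_vec R m i) \<in> {..<k} \<rightarrow>\<^sub>E carrier R"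
          using module_homD(1)[OF f unit_vec_closed, of i] by (simp only: free_module_sel(1))
        show "mat_hom R m k (?X f) (unit_vec R m i) l = f (unit_vec R m i) l" if "l < k" for l
          using mat_hom_unit_vec[OF Xc[OF f] i that] i that by simp
      qed
    qed
  qed
  show "mat_hom R m k ` ({..<k} \<rightarrow>\<^sub>E carrier (free_module R m))
      \<subseteq> module_hom R (free_module R m) (free_module R k)"
    using mat_hom_hom by blast
  show "?X ` module_hom R (free_module R m) (free_module R k)
      \<subseteq> {..<k} \<rightarrow>\<^sub>E carrier (free_module R m)"
    using Xc by blast
qed

lemma bij_betw_stack_rows:
  "bij_betw (\<lambda>(A, Y). stack_rows m n A Y)
    (({..<n} \<rightarrow>\<^sub>E carrier (free_module R m)) \<times> ({..<n} \<times> {..<m} \<rightarrow>\<^sub>E carrier R))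
    ({..<2 * n} \<rightarrow>\<^sub>E carrier (free_module R m))"
proof (rule bij_betw_byWitness[of _ "\<lambda>Z. (restrict Z {..<n}, \<lambda>(k, i)\<in>{..<n} \<times> {..<m}. Z (n + k) i)"])
  let ?W = "\<lambda>Z. (restrict Z {..<n}, \<lambda>(k, i)\<in>{..<n} \<times> {..<m}. Z (n + k) i)"
  let ?A = "{..<n} \<rightarrow>\<^sub>E carrier (free_module R m)" and ?B = "{..<n} \<times> {..<m} \<rightarrow>\<^sub>E carrier R"
  let ?C = "{..<2 * n} \<rightarrow>\<^sub>E carrier (free_module R m)"
  show "\<forall>p\<in>?A \<times> ?B. ?W ((\<lambda>(A, Y). stack_rows m n A Y) p) = p"
  proof
    fix p assume "p \<in> ?A \<times> ?B"
    then obtain A Y where p: "p = (A, Y)" and A: "A \<in> ?A" and Y: "Y \<in> ?B" by blast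
    have "restrict (stack_rows m n A Y) {..<n} = A"
      by (rule extensionalityI[of _ "{..<n}"]) (use A in \<open>auto simp: stack_rows_def PiE_def\<close>)
    moreover have "(\<lambda>(k, i)\<in>{..<n} \<times> {..<m}. stack_rows m n A Y (n + k) i) = Y"
      by (rule extensionalityI[of _ "{..<n} \<times> {..<m}"]) (use Y in \<open>auto simp: stack_rows_def PiE_def\<close>)
    ultimately show "?W ((\<lambda>(A, Y). stack_rows m n A Y) p) = p" by (simp add: p)
  qed
  show "\<forall>Z\<in>?C. (\<lambda>(A, Y). stack_rows m n A Y) (?W Z) = Z"
  proof
    fix Z assume Z: "Z \<in> ?C"
    have Zl: "Z l \<in> {..<m} \<rightarrow>\<^sub>E carrier R" if "l < 2 * n" for l
      using PiE_mem[OF Z, of l] that by (simp add: free_module_sel(1))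
    show "(\<lambda>(A, Y). stack_rows m n A Y) (?W Z) = Z"
    proof (rule extensionalityI[of _ "{..<2 * n}"])
      show "(\<lambda>(A, Y). stack_rows m n A Y) (?W Z) \<in> extensional {..<2 * n}"
        by (simp add: stack_rows_def)
      show "Z \<in> extensional {..<2 * n}" using Z by (simp add: PiE_def)
      fix l assume "l \<in> {..<2 * n}"
      then have l: "l < 2 * n" by simp
      show "(\<lambda>(A, Y). stack_rows m n A Y) (?W Z) l = Z l"
      proof (cases "l < n")
        case True
        then show ?thesis by (simp add: stack_rows_def)
      next
        case False
        then have "(\<lambda>i\<in>{..<m}. Z l i) = Z l"
          using Zl[OF l] by (intro extensionalityI[of _ "{..<m}"]) (auto simp: PiE_def)
        moreover have "(\<lambda>(A, Y). stack_rows m n A Y) (?W Z) l = (\<lambda>i\<in>{..<m}. Z l i)"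
          using False l by (auto simp: stack_rows_def fun_eq_iff)
        ultimately show ?thesis by simp
      qed
    qed
  qed
  show "(\<lambda>(A, Y). stack_rows m n A Y) ` (?A \<times> ?B) \<subseteq> ?C"
  proof clarify
    fix A Y assume A: "A \<in> ?A" and Y: "Y \<in> ?B"
    have "(if l < n then A l else (\<lambda>i\<in>{..<m}. Y (l - n, i))) \<in> carrier (free_module R m)"
      if "l < 2 * n" for l
      using PiE_mem[OF A, of l] PiE_mem[OF Y, of "(l - n, _)"] that by (simp add: free_module_sel(1))
    then show "stack_rows m n A Y \<in> ?C" by (simp add: stack_rows_def)
  qed
  show "?W ` ?C \<subseteq> ?A \<times> ?B"
  proof
    fix p assume "p \<in> ?W ` ?C"
    then obtain Z where Z: "Z \<in> ?C" and p: "p = ?W Z" by blast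
    have "Z l \<in> carrier (free_module R m)" if "l < 2 * n" for l
      using PiE_mem[OF Z, of l] that by simp
    moreover have "Z (n + k) i \<in> carrier R" if "k < n" "i < m" for k i
      using PiE_mem[OF Z, of "n + k"] that by (auto simp: free_module_sel(1))
    ultimately show "p \<in> ?A \<times> ?B" unfolding p by auto
  qed
qed

text \<open>A quadratic form on a span is determined by its values on the generators and by the
  polar form on pairs of distinct ones. Diagonal values of the polar form are twice those of
  \<open>Q\<close>, so they vanish too.\<close>

lemma isotropic_iff_basis:
  assumes f: "f \<in> module_hom R (free_module R m) (free_module R (2 * n))"
  shows "(\<forall>x\<in>carrier (free_module R m). hyperbolic_form R n (f x) = \<zero>) \<longleftrightarrow>
    (\<forall>i<m. hyperbolic_form R n (f (unit_vec R m i)) = \<zero> \<and>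
      (\<forall>j<i. polar_form R n (f (unit_vec R m i)) (f (unit_vec R m j)) = \<zero>))"
  (is "?L \<longleftrightarrow> ?R")
proof
  have fc: "f x \<in> carrier (free_module R (2 * n))" if "x \<in> carrier (free_module R m)" for x
    using f that by (rule module_homD(1))
  show ?R if Q: ?L
  proof -
    have "polar_form R n (f x) (f y) = \<zero>"
      if x: "x \<in> carrier (free_module R m)" and y: "y \<in> carrier (free_module R m)" for x y
    proof -
      have "hyperbolic_form R n (f (x \<oplus>\<^bsub>free_module R m\<^esub> y)) = polar_form R n (f x) (f y)"
        unfolding module_homD(2)[OF f x y] hyperbolic_form_add[OF fc[OF x] fc[OF y]]
        using Q x y fc by simp
      then show ?thesis using Q free_module_closed(1)[OF x y] by simp
    qed
    then show ?R using Q unit_vec_closed by blast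
  qed
  show ?L if b: ?R
  proof -
    have B: "polar_form R n (f (unit_vec R m i)) (f (unit_vec R m j)) = \<zero>" if "i < m" "j < m" for i j
    proof (rule linorder_cases[of i j])
      assume "i < j"
      then show ?thesis
        using b that polar_form_commute[OF fc[OF unit_vec_closed] fc[OF unit_vec_closed], of i j] by simp
    next
      assume "i = j"
      then show ?thesis using b that polar_form_self[OF fc[OF unit_vec_closed], of i] by simp
    qed (use b that in simp)
    \<comment> \<open>Orthogonality of \<open>f x\<close> to all generators is carried along,
      because it kills the cross term when a multiple of a generator is added.\<close>
    have "hyperbolic_form R n (f x) = \<zero> \<and> (\<forall>j<m. polar_form R n (f (unit_vec R m j)) (f x) = \<zero>)"
      if "x \<in> carrier (free_module R m)" for x
      using that
    proof (induction rule: free_module_induct)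
      case zero
      have z: "\<zero>\<^bsub>free_module R m\<^esub> \<in> carrier (free_module R m)"
        by (rule abelian_monoid.zero_closed)
          (use module_free_module in \<open>simp add: module_def abelian_group_def\<close>)
      \<comment> \<open>Writing the image of zero as a multiple by the scalar zero lets homogeneity
        of both forms finish the base case.\<close>
      then have e: "f \<zero>\<^bsub>free_module R m\<^esub> = \<zero> \<odot>\<^bsub>free_module R (2 * n)\<^esub> f \<zero>\<^bsub>free_module R m\<^esub>"
        using module_homD(3)[OF f zero_closed z] module.smult_l_null[OF module_free_module z] by simp
      show ?case
        by (subst e, subst (2) e) (use fc[OF z] fc in \<open>simp add: hyperbolic_form_smult polar_form_smult\<close>)
    next
      case (add x a i)
      have c: "f x \<in> carrier (free_module R (2 * n))" "f (unit_vec R m i) \<in> carrier (free_module R (2 * n))"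
        "a \<odot>\<^bsub>free_module R (2 * n)\<^esub> f (unit_vec R m i) \<in> carrier (free_module R (2 * n))"
        using fc[OF add.hyps(1)] fc[OF unit_vec_closed] free_module_closed(2)[OF add.hyps(2)] by blast+
      show ?case
        unfolding module_hom_add_smult[OF f add.hyps(1,2) unit_vec_closed]
        using add c b B fc[OF unit_vec_closed] polar_form_commute[OF c(1,2)]
        by (simp add: hyperbolic_form_add hyperbolic_form_smult polar_form_add polar_form_smult)
    qed
    then show ?L by blast
  qed
qed

text \<open>\<open>Q\<close> at the image of \<open>e_i\<close> is the diagonal entry of
  \<open>A^T Y\<close>, and the polar form at the images of \<open>e_i\<close> and
  \<open>e_j\<close> is the sum of the two entries in mirrored positions.\<close>

lemma isotropic_stack_rows_iff:
  assumes A: "A \<in> {..<n} \<rightarrow>\<^sub>E carrier (free_module R m)" and Y: "Y \<in> {..<n} \<times> {..<m} \<rightarrow>\<^sub>E carrier R"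
  shows "(\<forall>x\<in>carrier (free_module R m).
      hyperbolic_form R n (mat_hom R m (2 * n) (stack_rows m n A Y) x) = \<zero>) \<longleftrightarrow>
    Y \<in> alternating_partners R m n A"
proof -
  have Z: "stack_rows m n A Y \<in> {..<2 * n} \<rightarrow>\<^sub>E carrier (free_module R m)"
    using bij_betw_stack_rows[of m n] A Y by (auto simp: bij_betw_def)
  let ?f = "mat_hom R m (2 * n) (stack_rows m n A Y)"
  have e: "?f (unit_vec R m i) k = A k i" "?f (unit_vec R m i) (n + k) = Y (k, i)" if "k < n" "i < m" for k i
    using mat_hom_unit_vec[OF Z that(2)] that by (simp_all add: stack_rows_def)
  have Xc: "A k i \<in> carrier R" if "k < n" "i < m" for k i
    using PiE_mem[OF A, of k] that by (auto simp: free_module_sel(1))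
  have Yc: "Y (k, i) \<in> carrier R" if "k < n" "i < m" for k i
    using PiE_mem[OF Y, of "(k, i)"] that by auto
  have "hyperbolic_form R n (?f (unit_vec R m i)) = gram R n A Y i i" if "i < m" for i
    unfolding hyperbolic_form_def gram_def
    by (rule finsum_cong') (use that e Xc Yc in auto)
  moreover have "polar_form R n (?f (unit_vec R m i)) (?f (unit_vec R m j)) =
      gram R n A Y i j \<oplus> gram R n A Y j i" if "i < m" "j < i" for i j
  proof -
    have "polar_form R n (?f (unit_vec R m i)) (?f (unit_vec R m j)) =
        (\<Oplus>k\<in>{..<n}. A k i \<otimes> Y (k, j) \<oplus> A k j \<otimes> Y (k, i))"
      unfolding polar_form_def by (rule finsum_cong') (use that e Xc Yc m_comm in auto)
    also have "\<dots> = gram R n A Y i j \<oplus> gram R n A Y j i"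
      unfolding gram_def using that Xc Yc by (subst finsum_addf[symmetric]) auto
    finally show ?thesis .
  qed
  ultimately show ?thesis
    unfolding isotropic_iff_basis[OF mat_hom_hom[OF Z]] alternating_partners_def
    using Y by auto
qed

end

text \<open>Of an \<open>m\<close> by \<open>m\<close> block of entries the strictly lower triangle
  will be free and the remainder determined.\<close>

lemma sum_lessThan_add_triangle: "m * (m - 1) div 2 + m * (m + 1) div 2 = m * (m::nat)"
proof -
  have "even (m * (m - 1))" by (cases m) auto
  then obtain a where a: "m * (m - 1) = 2 * a" by blast
  then have "m * (m + 1) = 2 * (a + m)" "m * m = 2 * a + m" by (cases m; simp)+
  with a show ?thesis by simp
qed

section \<open>The number of alternating partners of a matrix with all unit rows\<close>

context cring
begin

text \<open>For each \<open>i\<close> fix a row \<open>r i\<close> of \<open>A\<close> equal to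
  \<open>e_i\<close>. Then \<open>Y (r i, j)\<close> occurs with coefficient one in the entry
  \<open>(i, j)\<close> of \<open>A^T Y\<close> and, among the rows in the range of
  \<open>r\<close>, is the only contribution to it. So each of the \<open>m (m + 1) / 2\<close>
  equations determines one entry of \<open>Y\<close>. The product form of the claim avoids
  subtraction in the exponent.\<close>

lemma card_alternating_partners:
  assumes fin: "finite (carrier R)" and nontrivial: "\<one> \<noteq> \<zero>"
    and A: "A \<in> {..<n} \<rightarrow>\<^sub>E carrier (free_module R m)"
    and unit_rows: "\<forall>j<m. \<exists>k<n. A k = unit_vec R m j"
  shows "card (alternating_partners R m n A) * card (carrier R) ^ (m * (m + 1) div 2) =
    card (carrier R) ^ (n * m)"
proof -
  have "\<forall>j\<in>{..<m}. \<exists>k. k < n \<and> A k = unit_vec R m j" using unit_rows by auto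
  then obtain r where r: "\<And>j. j < m \<Longrightarrow> r j < n" "\<And>j. j < m \<Longrightarrow> A (r j) = unit_vec R m j"
    using bchoice[of "{..<m}" "\<lambda>j k. k < n \<and> A k = unit_vec R m j"] by auto
  \<comment> \<open>In a nontrivial ring distinct indices have distinct basis vectors, so
    \<open>r\<close> selects distinct rows.\<close>
  have r_eq: "r i = r j \<longleftrightarrow> i = j" if "i < m" "j < m" for i j
  proof
    assume "r i = r j"
    then have "unit_vec R m i i = unit_vec R m j i" using r(2) that by metis
    then show "i = j" using nontrivial that by (simp split: if_splits)
  qed simp
  then have inj: "inj_on r {..<m}" by (auto simp: inj_on_def)
  \<comment> \<open>\<open>D\<close> consists of the rows not selected and \<open>T\<close> is their
    share of \<open>A^T Y\<close>. The free positions \<open>F\<close> are all entries in rows of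
    \<open>D\<close>, together with those at \<open>(r i, j)\<close> with
    \<open>j < i\<close>.\<close>
  define D where "D = {..<n} - r ` {..<m}"
  define T where "T Y i j = (\<Oplus>k\<in>D. A k i \<otimes> Y (k, j))" for Y :: "nat \<times> nat \<Rightarrow> 'a" and i j
  define F where "F = D \<times> {..<m} \<union> (\<lambda>(i, j). (r i, j)) ` (SIGMA i:{..<m}. {..<i})"
  let ?P = "{..<n} \<times> {..<m} \<rightarrow>\<^sub>E carrier R"
  have Ac: "A k i \<in> carrier R" if "k < n" "i < m" for k i
    using PiE_mem[OF A, of k] that by (auto simp: free_module_sel(1))
  have D: "k < n" "finite D" "k \<in> D \<Longrightarrow> j < m \<Longrightarrow> (k, j) \<in> F" if "k \<in> D" for k j
    using that by (auto simp: D_def F_def)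
  have Fsub: "F \<subseteq> {..<n} \<times> {..<m}"
    using r by (auto simp: F_def D_def)
  have rF: "(r i, j) \<in> F \<longleftrightarrow> j < i" if "i < m" "j < m" for i j
  proof
    assume "(r i, j) \<in> F"
    moreover have "r i \<notin> D" using that by (auto simp: D_def)
    ultimately obtain i' where "i' < m" "r i = r i'" "j < i'" by (auto simp: F_def)
    then show "j < i" using r_eq[OF that(1)] by simp
  next
    assume "j < i"
    then show "(r i, j) \<in> F" using that by (auto simp: F_def image_iff)
  qed
  have gram: "gram R n A Y i j = Y (r i, j) \<oplus> T Y i j"
    if Y: "\<And>k j. k < n \<Longrightarrow> j < m \<Longrightarrow> Y (k, j) \<in> carrier R" and ij: "i < m" "j < m" for Y i j
  proof -
    have c: "A k i \<otimes> Y (k, j) \<in> carrier R" if "k < n" for k using Ac Y ij that by simp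
    have "{..<n} = r ` {..<m} \<union> D" using r by (auto simp: D_def)
    then have "gram R n A Y i j = (\<Oplus>k\<in>r ` {..<m} \<union> D. A k i \<otimes> Y (k, j))"
      by (simp only: gram_def)
    also have "\<dots> = (\<Oplus>k\<in>r ` {..<m}. A k i \<otimes> Y (k, j)) \<oplus> (\<Oplus>k\<in>D. A k i \<otimes> Y (k, j))"
    proof (rule finsum_Un_disjoint)
      show "(\<lambda>k. A k i \<otimes> Y (k, j)) \<in> r ` {..<m} \<rightarrow> carrier R" using c r(1) by blast
      show "(\<lambda>k. A k i \<otimes> Y (k, j)) \<in> D \<rightarrow> carrier R" using c D(1) by blast
    qed (simp_all add: D_def disjoint_iff)
    also have "(\<Oplus>k\<in>r ` {..<m}. A k i \<otimes> Y (k, j)) = (\<Oplus>l\<in>{..<m}. A (r l) i \<otimes> Y (r l, j))"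
      using inj c r by (intro finsum_reindex) auto
    also have "\<dots> = (\<Oplus>l\<in>{..<m}. if i = l then Y (r l, j) else \<zero>)"
      by (rule finsum_cong') (use ij r Y in auto)
    also have "\<dots> = Y (r i, j)"
      using ij r Y by (intro add.finprod_singleton) auto
    finally show ?thesis by (simp add: T_def)
  qed
  have T_closed: "T Y i j \<in> carrier R" if "\<And>k. k \<in> D \<Longrightarrow> Y (k, j) \<in> carrier R" "i < m" for Y i j
    unfolding T_def using that Ac D(1) by (intro finsum_closed) auto
  have T_cong: "T Y i j = T Y' i j"
    if "\<And>k. k \<in> D \<Longrightarrow> Y' (k, j) \<in> carrier R" "\<And>k. k \<in> D \<Longrightarrow> Y (k, j) = Y' (k, j)" "i < m" for Y Y' i j
    unfolding T_def using that Ac D(1) by (intro finsum_cong') auto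
  text \<open>The entries of \<open>Y\<close> at \<open>F\<close> can be chosen freely and determine the others.\<close>
  define ext where "ext W = (\<lambda>(k, j)\<in>{..<n} \<times> {..<m}. if (k, j) \<in> F then W (k, j) else
    (let i = inv_into {..<m} r k in
      if i = j then \<ominus> T W i i else \<ominus> (T W i j \<oplus> W (r j, i) \<oplus> T W j i)))" for W
  have ext_D: "ext W (k, j) = W (k, j)" if "k \<in> D" "j < m" for W k j
    using D(1,3)[OF that(1)] that by (simp add: ext_def)
  \<comment> \<open>On the diagonal the value solves \<open>gram i i = 0\<close>; for
    \<open>i < j\<close> it solves \<open>gram i j + gram j i = 0\<close> for the entry at
    \<open>(r i, j)\<close>. There is no circularity: \<open>T\<close> sees only rows in
    \<open>D\<close>, and \<open>(r j, i)\<close> lies in \<open>F\<close>.\<close>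
  have ext_r: "ext W (r i, j) = (if j < i then W (r i, j) else if i = j then \<ominus> T W i i
      else \<ominus> (T W i j \<oplus> W (r j, i) \<oplus> T W j i))" if "i < m" "j < m" for W i j
    using that rF r(1) inv_into_f_f[OF inj, of i] by (simp add: ext_def)
  have cases: "k \<in> D \<or> (\<exists>i<m. k = r i)" if "k < n" for k
    using that by (auto simp: D_def)
  have W_closed: "W (k, j) \<in> carrier R" if "W \<in> F \<rightarrow>\<^sub>E carrier R" "(k, j) \<in> F" for W k j
    using PiE_mem[OF that] by simp
  have ext_closed: "ext W (k, j) \<in> carrier R"
    if W: "W \<in> F \<rightarrow>\<^sub>E carrier R" and kj: "k < n" "j < m" for W k j
  proof -
    have WD: "W (k, j) \<in> carrier R" if "k \<in> D" "j < m" for k j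
      using W_closed[OF W D(3)[OF that(1) that]] .
    show ?thesis
      using cases[OF kj(1)]
    proof
      assume "k \<in> D"
      then show ?thesis using WD kj by (simp add: ext_D)
    next
      assume "\<exists>i<m. k = r i"
      then obtain i where i: "i < m" "k = r i" by blast
      have "W (r i', j') \<in> carrier R" if "j' < i'" "i' < m" for i' j'
        using W_closed[OF W, of "r i'" j'] rF that by simp
      then show ?thesis
        using i kj T_closed[of W, OF WD] by (auto simp: ext_r not_less)
    qed
  qed
  have "bij_betw (\<lambda>Y. restrict Y F) (alternating_partners R m n A) (F \<rightarrow>\<^sub>E carrier R)"
  proof (rule bij_betw_byWitness[of _ ext])
    have Yc: "Y (k, j) \<in> carrier R"
      if "Y \<in> alternating_partners R m n A" "k < n" "j < m" for Y k j
      using PiE_mem[of Y "{..<n} \<times> {..<m}" "\<lambda>_. carrier R" "(k, j)"] that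
      by (simp add: alternating_partners_def)
    show "\<forall>Y\<in>alternating_partners R m n A. ext (restrict Y F) = Y"
    proof
      fix Y assume Y: "Y \<in> alternating_partners R m n A"
      note c = Yc[OF Y]
      have TY: "T (restrict Y F) i j = T Y i j" if "i < m" "j < m" for i j
        by (rule T_cong) (use that c D(1,3) in auto)
      have Tc: "T Y i j \<in> carrier R" if "i < m" "j < m" for i j
        by (rule T_closed) (use that c D(1) in auto)
      have Yrii: "Y (r i, i) = \<ominus> T Y i i" if "i < m" for i
      proof -
        have "Y (r i, i) \<oplus> T Y i i = \<zero>"
          using Y that gram[of Y i i] c by (simp add: alternating_partners_def)
        then show ?thesis using c r(1) Tc that by (simp add: minus_equality)
      qed
      have Yrij: "Y (r i, j) = \<ominus> (T Y i j \<oplus> Y (r j, i) \<oplus> T Y j i)" if "i < j" "j < m" for i j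
      proof -
        have ij: "i < m" using that by simp
        have "gram R n A Y j i \<oplus> gram R n A Y i j = \<zero>"
          using Y that by (simp add: alternating_partners_def)
        then have "(Y (r j, i) \<oplus> T Y j i) \<oplus> (Y (r i, j) \<oplus> T Y i j) = \<zero>"
          using gram[of Y i j] gram[of Y j i] c ij that by simp
        then have "Y (r i, j) \<oplus> (T Y i j \<oplus> Y (r j, i) \<oplus> T Y j i) = \<zero>"
          using c r(1) Tc ij that by (simp add: a_ac)
        then show ?thesis
          using c r(1) Tc ij that by (intro minus_equality[symmetric]) (auto simp: a_ac)
      qed
      show "ext (restrict Y F) = Y"
      proof (rule extensionalityI[of _ "{..<n} \<times> {..<m}"])
        show "ext (restrict Y F) \<in> extensional ({..<n} \<times> {..<m})" by (simp add: ext_def)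
        show "Y \<in> extensional ({..<n} \<times> {..<m})"
          using Y by (simp add: alternating_partners_def PiE_def)
        fix p assume "p \<in> {..<n} \<times> {..<m}"
        then obtain k j where p: "p = (k, j)" and kj: "k < n" "j < m" by blast
        show "ext (restrict Y F) p = Y p"
          using cases[OF kj(1)]
        proof
          assume k: "k \<in> D"
          then show ?thesis using kj ext_D D(3)[OF k k] by (simp add: p)
        next
          assume "\<exists>i<m. k = r i"
          then obtain i where i: "i < m" "k = r i" by blast
          show ?thesis
            unfolding p i(2) ext_r[OF i(1) kj(2)]
            using i(1) kj(2) rF Yrii Yrij[of i j] by (simp add: TY)
        qed
      qed
    qed
    show "\<forall>W\<in>F \<rightarrow>\<^sub>E carrier R. restrict (ext W) F = W"
    proof
      fix W assume W: "W \<in> F \<rightarrow>\<^sub>E carrier R"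
      show "restrict (ext W) F = W"
      proof (rule extensionalityI[of _ F])
        show "W \<in> extensional F" using W by (simp add: PiE_def)
        fix p assume "p \<in> F"
        then show "restrict (ext W) F p = W p" using Fsub by (cases p) (auto simp: ext_def)
      qed simp
    qed
    show "(\<lambda>Y. restrict Y F) ` alternating_partners R m n A \<subseteq> F \<rightarrow>\<^sub>E carrier R"
    proof clarify
      fix Y assume "Y \<in> alternating_partners R m n A"
      then have "Y p \<in> carrier R" if "p \<in> F" for p using Yc that Fsub by (cases p) auto
      then show "restrict Y F \<in> F \<rightarrow>\<^sub>E carrier R" by simp
    qed
    show "ext ` (F \<rightarrow>\<^sub>E carrier R) \<subseteq> alternating_partners R m n A"
    proof clarify
      fix W assume W: "W \<in> F \<rightarrow>\<^sub>E carrier R"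
      have "ext W \<in> ?P"
      proof (rule PiE_I)
        fix p assume "p \<in> {..<n} \<times> {..<m}"
        then show "ext W p \<in> carrier R" using ext_closed[OF W] by (cases p) simp
      qed (auto simp: ext_def)
      moreover have TW: "T (ext W) i j = T W i j" "T W i j \<in> carrier R" if "i < m" "j < m" for i j
        using that W_closed[OF W] D(3) by (auto intro!: T_cong T_closed simp: ext_D)
      moreover have "gram R n A (ext W) i i = \<zero>" if "i < m" for i
        using that gram[of "ext W" i i, OF ext_closed[OF W]] TW by (simp add: ext_r l_neg)
      moreover have "gram R n A (ext W) i j \<oplus> gram R n A (ext W) j i = \<zero>" if "i < m" "j < i" for i j
      proof -
        have j: "j < m" using that by simp
        have Wij: "W (r i, j) \<in> carrier R" using W_closed[OF W] rF that j by simp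
        have "gram R n A (ext W) i j \<oplus> gram R n A (ext W) j i =
            W (r i, j) \<oplus> T W i j \<oplus> (\<ominus> (T W j i \<oplus> W (r i, j) \<oplus> T W i j) \<oplus> T W j i)"
          using that j gram[of "ext W", OF ext_closed[OF W]] TW by (simp add: ext_r)
        also have "\<dots> = \<zero>"
        proof -
          have "u \<oplus> (\<ominus> (z \<oplus> u) \<oplus> z) = \<zero>" if "u \<in> carrier R" "z \<in> carrier R" for u z
            using that by (simp add: minus_add a_comm[of "\<ominus> z"] a_assoc l_neg r_neg)
          from this[of "W (r i, j) \<oplus> T W i j" "T W j i"] show ?thesis
            using Wij TW(2)[OF that(1) j] TW(2)[OF j that(1)] by (simp add: a_assoc)
        qed
        finally show ?thesis .
      qed
      ultimately show "ext W \<in> alternating_partners R m n A" by (simp add: alternating_partners_def)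
    qed
  qed
  then have "card (alternating_partners R m n A) = card (F \<rightarrow>\<^sub>E carrier R)"
    by (rule bij_betw_same_card)
  also have "\<dots> = card (carrier R) ^ card F"
    using finite_subset[OF Fsub] by (intro card_funcsetE) simp
  finally have card: "card (alternating_partners R m n A) = card (carrier R) ^ card F" .
  have "card F + m * (m + 1) div 2 = n * m"
  proof -
    have rm: "r ` {..<m} \<subseteq> {..<n}" using r by auto
    have cr: "card (r ` {..<m}) = m" using inj by (simp add: card_image)
    \<comment> \<open>The \<open>m\<close> selected rows are distinct, which gives the inequality
      that the natural number subtraction \<open>n - m\<close> requires.\<close>
    have mn: "m \<le> n" using card_mono[OF _ rm] cr by simp
    have "card F = card (D \<times> {..<m}) + card ((\<lambda>(i, j). (r i, j)) ` (SIGMA i:{..<m}. {..<i}))"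
      unfolding F_def by (rule card_Un_disjoint) (auto simp: D_def)
    also have "card (D \<times> {..<m}) = (n - m) * m"
      using card_Diff_subset[OF _ rm] cr by (simp add: D_def card_cartesian_product)
    also have "card ((\<lambda>(i, j). (r i, j)) ` (SIGMA i:{..<m}. {..<i})) = card (SIGMA i:{..<m}. {..<i})"
      by (rule card_image) (auto simp: inj_on_def r_eq)
    also have "\<dots> = m * (m - 1) div 2" by (simp add: lessThan_atLeast0 Sum_Ico_nat)
    finally have "card F + m * (m + 1) div 2 = (n - m) * m + m * m"
      using sum_lessThan_add_triangle[of m] by simp
    then show ?thesis using mn by (simp add: algebra_simps flip: distrib_right)
  qed
  then show ?thesis unfolding card by (metis power_add)
qed

end

section \<open>Bounds for the two counts of maps\<close>

definition unit_row_matrices :: "('a, 'r) ring_scheme \<Rightarrow> nat \<Rightarrow> nat \<Rightarrow> (nat \<Rightarrow> nat \<Rightarrow> 'a) set" where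
  "unit_row_matrices R m n = {A \<in> {..<n} \<rightarrow>\<^sub>E carrier (free_module R m).
     \<forall>j<m. \<exists>k<n. A k = unit_vec R m j}"

context cring
begin

lemma card_free_module: "card (carrier (free_module R k)) = card (carrier R) ^ k"
  by (simp add: free_module_sel(1) card_funcsetE)

lemma card_matrices:
  "card ({..<n} \<rightarrow>\<^sub>E carrier (free_module R m)) = card (carrier R) ^ (n * m)"
  by (simp add: card_funcsetE card_free_module mult.commute flip: power_mult)

text \<open>A union bound: a matrix outside the set misses some \<open>e_j\<close>, so each of its
  \<open>n\<close> rows is one of the other \<open>q^m - 1\<close> vectors. For growing
  \<open>n\<close> this is an exponentially small share of all matrices.\<close>

lemma card_non_unit_row_matrices:
  assumes fin: "finite (carrier R)"
  shows "card ({..<n} \<rightarrow>\<^sub>E carrier (free_module R m)) \<le>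
    card (unit_row_matrices R m n) + m * (card (carrier R) ^ m - 1) ^ n"
proof -
  let ?V = "carrier (free_module R m)" and ?G = "unit_row_matrices R m n"
  let ?B = "\<lambda>j. {..<n} \<rightarrow>\<^sub>E (?V - {unit_vec R m j})"
  have finV: "finite ?V" by (rule finite_free_module[OF fin])
  have "{..<n} \<rightarrow>\<^sub>E ?V \<subseteq> ?G \<union> (\<Union>j<m. ?B j)"
  proof
    fix A assume A: "A \<in> {..<n} \<rightarrow>\<^sub>E ?V"
    show "A \<in> ?G \<union> (\<Union>j<m. ?B j)"
    proof (cases "A \<in> ?G")
      case False
      then obtain j where j: "j < m" "\<And>k. k < n \<Longrightarrow> A k \<noteq> unit_vec R m j"
        using A by (auto simp: unit_row_matrices_def)
      have "A \<in> ?B j"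
        using A j(2) by (auto simp: PiE_iff)
      then show ?thesis using j(1) by blast
    qed simp
  qed
  moreover have "finite ?G"
    by (rule finite_subset[OF _ finite_PiE[OF finite_lessThan, of n "\<lambda>_. ?V"]])
      (auto simp: unit_row_matrices_def finV)
  moreover have finB: "finite (?B j)" for j by (intro finite_PiE) (auto simp: finV)
  ultimately have "card ({..<n} \<rightarrow>\<^sub>E ?V) \<le> card (?G \<union> (\<Union>j<m. ?B j))"
    by (intro card_mono) auto
  also have "\<dots> \<le> card ?G + card (\<Union>j<m. ?B j)" by (rule card_Un_le)
  also have "card (\<Union>j<m. ?B j) \<le> (\<Sum>j<m. card (?B j))" by (rule card_UN_le) simp
  also have "\<dots> = m * (card (carrier R) ^ m - 1) ^ n"
    by (simp add: card_funcsetE card_free_module)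
  finally show ?thesis by simp
qed

text \<open>The row \<open>e_j\<close> copies coordinate \<open>j\<close> of the argument into the
  image, from which the argument can be read off.\<close>

lemma mat_hom_inj_on:
  assumes A: "A \<in> {..<k} \<rightarrow>\<^sub>E carrier (free_module R m)"
    and unit_rows: "\<And>j. j < m \<Longrightarrow> \<exists>l<k. A l = unit_vec R m j"
  shows "inj_on (mat_hom R m k A) (carrier (free_module R m))"
proof (rule inj_onI)
  fix x y assume xy: "x \<in> carrier (free_module R m)" "y \<in> carrier (free_module R m)"
    and e: "mat_hom R m k A x = mat_hom R m k A y"
  then have xy': "x \<in> {..<m} \<rightarrow>\<^sub>E carrier R" "y \<in> {..<m} \<rightarrow>\<^sub>E carrier R"
    by (simp_all add: free_module_sel(1))
  show "x = y"
  proof (rule vec_eqI[OF xy'])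
    fix j assume j: "j < m"
    then obtain l where l: "l < k" "A l = unit_vec R m j" using unit_rows by blast
    have "mat_hom R m k A x l = mat_hom R m k A y l" using e by simp
    then show "x j = y j" using l xy dot_unit_vec(2)[OF _ j] xy' by (simp add: mat_hom_def)
  qed
qed

lemma num_injective_homs_free_module_bounds:
  assumes fin: "finite (carrier R)"
  shows "card (unit_row_matrices R m n) \<le> num_injective_homs R m (free_module R n)"
    and "num_injective_homs R m (free_module R n) \<le> card (carrier R) ^ (n * m)"
proof -
  let ?H = "module_hom R (free_module R m) (free_module R n)"
  note b = bij_betw_mat_hom[of m n]
  have fH: "finite ?H" by (intro finite_module_hom finite_free_module fin)
  show "card (unit_row_matrices R m n) \<le> num_injective_homs R m (free_module R n)"
    unfolding num_injective_homs_def
  proof (rule card_inj_on_le[of "mat_hom R m n"])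
    show "inj_on (mat_hom R m n) (unit_row_matrices R m n)"
      using b by (auto simp: bij_betw_def unit_row_matrices_def inj_on_def)
    show "mat_hom R m n ` unit_row_matrices R m n \<subseteq> {f \<in> ?H. inj_on f (carrier (free_module R m))}"
      using mat_hom_hom mat_hom_inj_on unfolding unit_row_matrices_def by blast
  qed (use fH in simp)
  have "num_injective_homs R m (free_module R n) \<le> card ?H"
    unfolding num_injective_homs_def using fH by (intro card_mono) auto
  also have "\<dots> = card (carrier R) ^ (n * m)"
    using bij_betw_same_card[OF b] card_matrices by simp
  finally show "num_injective_homs R m (free_module R n) \<le> card (carrier R) ^ (n * m)" .
qed

text \<open>Maps are counted as pairs \<open>(A, Y)\<close>. Each \<open>A\<close> with all unit
  rows has exactly \<open>q^(n m) / q^t\<close> partners and gives only injective maps. For any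
  other \<open>A\<close> the trivial bound by all \<open>q^(n m)\<close> choices of \<open>Y\<close>
  is good enough, as such \<open>A\<close> are rare.\<close>

lemma card_isotropic_injections_bounds:
  fixes m n :: nat
  assumes fin: "finite (carrier R)" and nontrivial: "\<one> \<noteq> \<zero>"
  defines "q \<equiv> card (carrier R)" and "G \<equiv> card (unit_row_matrices R m n)"
    and "t \<equiv> m * (m + 1) div 2"
  shows "G * q ^ (n * m) \<le> card (isotropic_injections R m n) * q ^ t"
    and "card (isotropic_injections R m n) * q ^ t \<le>
      G * q ^ (n * m) + (q ^ (n * m) - G) * q ^ (n * m) * q ^ t"
proof -
  let ?V = "carrier (free_module R m)" and ?P = "alternating_partners R m n"
  let ?X = "{..<n} \<rightarrow>\<^sub>E ?V" and ?U = "unit_row_matrices R m n" and ?N = "isotropic_injections R m n"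
  define h where "h = (\<lambda>(A, Y). mat_hom R m (2 * n) (stack_rows m n A Y))"
  have finV: "finite ?V" and finX: "finite ?X"
    using finite_free_module[OF fin] by (auto intro: finite_PiE)
  have UX: "?U \<subseteq> ?X" by (auto simp: unit_row_matrices_def)
  then have finU: "finite ?U" using finX finite_subset by blast
  have P: "?P A \<subseteq> {..<n} \<times> {..<m} \<rightarrow>\<^sub>E carrier R" for A by (auto simp: alternating_partners_def)
  have finY: "finite ({..<n} \<times> {..<m} \<rightarrow>\<^sub>E carrier R)" using fin by (intro finite_PiE) auto
  have finP: "finite (?P A)" for A using P finY finite_subset by blast
  have finN: "finite ?N"
    unfolding isotropic_injections_def
    using finite_module_hom[OF finite_free_module[OF fin] finite_free_module[OF fin]] by simp
  have Z: "stack_rows m n A Y \<in> {..<2 * n} \<rightarrow>\<^sub>E ?V" if "A \<in> ?X" "Y \<in> ?P A" for A Y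
    using bspec[OF bij_betwE[OF bij_betw_stack_rows[of m n]], of "(A, Y)"] P[of A] that by auto
  have PU: "card (?P A) * q ^ t = q ^ (n * m)" if "A \<in> ?U" for A
    unfolding q_def t_def using that
    by (intro card_alternating_partners fin nontrivial) (auto simp: unit_row_matrices_def)
  have PX: "card (?P A) \<le> q ^ (n * m)" for A
    using card_mono[OF finY P[of A]] by (simp add: card_funcsetE q_def card_cartesian_product)
  have inj_h: "inj_on h (SIGMA A:?X. ?P A)"
  proof -
    have "inj_on (mat_hom R m (2 * n) \<circ> (\<lambda>(A, Y). stack_rows m n A Y))
        (?X \<times> ({..<n} \<times> {..<m} \<rightarrow>\<^sub>E carrier R))"
      using bij_betw_trans[OF bij_betw_stack_rows bij_betw_mat_hom[of m "2 * n"]]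
      by (simp add: bij_betw_def)
    moreover have "h = mat_hom R m (2 * n) \<circ> (\<lambda>(A, Y). stack_rows m n A Y)"
      by (auto simp: h_def fun_eq_iff)
    ultimately have "inj_on h (?X \<times> ({..<n} \<times> {..<m} \<rightarrow>\<^sub>E carrier R))" by simp
    then show ?thesis by (rule inj_on_subset) (use P in blast)
  qed
  have "card (SIGMA A:?U. ?P A) \<le> card ?N"
  proof (rule card_inj_on_le[of h])
    show "inj_on h (SIGMA A:?U. ?P A)"
      by (rule inj_on_subset[OF inj_h]) (use UX in auto)
    show "h ` (SIGMA A:?U. ?P A) \<subseteq> ?N"
    proof clarify
      fix A Y assume A: "A \<in> ?U" and Y: "Y \<in> ?P A"
      have AX: "A \<in> ?X" using A UX by blast
      have rows: "\<exists>l<2 * n. stack_rows m n A Y l = unit_vec R m j" if j: "j < m" for j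
      proof -
        obtain k where "k < n" "A k = unit_vec R m j" using A j by (auto simp: unit_row_matrices_def)
        then show ?thesis by (intro exI[of _ k]) (simp add: stack_rows_def)
      qed
      show "h (A, Y) \<in> ?N"
        unfolding isotropic_injections_def h_def
        using mat_hom_hom[OF Z[OF AX Y]] mat_hom_inj_on[OF Z[OF AX Y] rows]
          isotropic_stack_rows_iff[of A n m Y] AX Y P by auto
    qed
  qed (fact finN)
  then have "(\<Sum>A\<in>?U. card (?P A)) * q ^ t \<le> card ?N * q ^ t"
    using finU finP by simp
  moreover have "(\<Sum>A\<in>?U. card (?P A)) * q ^ t = G * q ^ (n * m)"
    unfolding sum_distrib_right by (simp add: PU G_def)
  ultimately show "G * q ^ (n * m) \<le> card ?N * q ^ t" by simp
  \<comment> \<open>The upper bound counts all isotropic maps, injective or not.\<close>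
  have "?N \<subseteq> h ` (SIGMA A:?X. ?P A)"
  proof
    fix f assume f: "f \<in> ?N"
    then have "f \<in> module_hom R (free_module R m) (free_module R (2 * n))"
      by (simp add: isotropic_injections_def)
    then obtain Z where Z: "Z \<in> {..<2 * n} \<rightarrow>\<^sub>E ?V" "f = mat_hom R m (2 * n) Z"
      using bij_betw_mat_hom[of m "2 * n"] by (auto simp: bij_betw_def)
    then have "Z \<in> (\<lambda>(A, Y). stack_rows m n A Y) ` (?X \<times> ({..<n} \<times> {..<m} \<rightarrow>\<^sub>E carrier R))"
      by (simp only: bij_betw_imp_surj_on[OF bij_betw_stack_rows])
    then obtain A Y where AY: "A \<in> ?X" "Y \<in> {..<n} \<times> {..<m} \<rightarrow>\<^sub>E carrier R" "Z = stack_rows m n A Y"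
      by auto
    have "Y \<in> ?P A"
      using f isotropic_stack_rows_iff[OF AY(1,2)] Z(2) AY(3) by (simp add: isotropic_injections_def)
    then show "f \<in> h ` (SIGMA A:?X. ?P A)"
      using AY(1) by (intro image_eqI[of _ _ "(A, Y)"]) (simp_all add: h_def Z(2) AY(3))
  qed
  then have "card ?N \<le> card (SIGMA A:?X. ?P A)"
    by (rule surj_card_le[rotated]) (use finX finP in auto)
  also have "\<dots> = (\<Sum>A\<in>?X. card (?P A))" using finX finP by simp
  also have "\<dots> = (\<Sum>A\<in>?U. card (?P A)) + (\<Sum>A\<in>?X - ?U. card (?P A))"
    using sum.subset_diff[OF UX finX] by (simp add: add.commute)
  also have "(\<Sum>A\<in>?X - ?U. card (?P A)) \<le> card (?X - ?U) * q ^ (n * m)"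
    using sum_bounded_above[of "?X - ?U" "\<lambda>A. card (?P A)"] PX by simp
  also have "card (?X - ?U) = q ^ (n * m) - G"
    using card_Diff_subset[OF finU UX] card_matrices by (simp add: q_def G_def)
  finally have "card ?N \<le> (\<Sum>A\<in>?U. card (?P A)) + (q ^ (n * m) - G) * q ^ (n * m)" by simp
  then have "card ?N * q ^ t \<le> ((\<Sum>A\<in>?U. card (?P A)) + (q ^ (n * m) - G) * q ^ (n * m)) * q ^ t"
    by (rule mult_le_mono1)
  then show "card ?N * q ^ t \<le> G * q ^ (n * m) + (q ^ (n * m) - G) * q ^ (n * m) * q ^ t"
    using \<open>(\<Sum>A\<in>?U. card (?P A)) * q ^ t = G * q ^ (n * m)\<close> by (simp add: add_mult_distrib)
qed

end

text \<open>To be applied with \<open>Q = |R|^m\<close>, \<open>q = |R|^(m (m + 1) / 2)\<close> and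
  \<open>c = m\<close>; \<open>G\<close> counts matrices with all unit rows, \<open>I\<close> and
  \<open>N\<close> the two kinds of injective maps. The second claim supplies the positivity under
  which the average equals the quotient.\<close>

lemma ratio_limit_from_bounds:
  fixes q Q c :: nat and G I N :: "nat \<Rightarrow> nat"
  assumes Q: "Q \<ge> 1" and q: "q > 0"
    and G: "\<And>n. Q ^ n \<le> G n + c * (Q - 1) ^ n" "\<And>n. G n \<le> Q ^ n"
    and I: "\<And>n. G n \<le> I n" "\<And>n. I n \<le> Q ^ n"
    and N: "\<And>n. G n * Q ^ n \<le> N n * q" "\<And>n. N n * q \<le> G n * Q ^ n + (Q ^ n - G n) * Q ^ n * q"
  shows "(\<lambda>n. (real (I n))\<^sup>2 / real (N n)) \<longlonglongrightarrow> real q"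
    and "eventually (\<lambda>n. N n > 0) sequentially"
proof -
  have Qn: "real Q ^ n > 0" for n using Q by simp
  \<comment> \<open>\<open>g\<close> is the share of matrices with all unit rows, and
    \<open>w\<close> is \<open>N\<close> relative to its expected size \<open>Q^(2 n) / q\<close>.
    Both are shown to tend to 1.\<close>
  define g where "g n = real (G n) / real Q ^ n" for n
  define w where "w n = real (N n) * real q / (real Q ^ n)\<^sup>2" for n
  have G': "real Q ^ n \<le> real (G n) + real c * (real Q - 1) ^ n" "real (G n) \<le> real Q ^ n"
    and I': "real (G n) \<le> real (I n)" "real (I n) \<le> real Q ^ n"
    and N': "real (G n) * real Q ^ n \<le> real (N n) * real q"
      "real (N n) * real q \<le> real (G n) * real Q ^ n + (real Q ^ n - real (G n)) * real Q ^ n * real q"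
    for n
  proof -
    show "real Q ^ n \<le> real (G n) + real c * (real Q - 1) ^ n"
      using of_nat_mono[OF G(1)[of n], where 'a = real] Q by (simp add: of_nat_diff)
    show "real (G n) * real Q ^ n \<le> real (N n) * real q"
      using of_nat_mono[OF N(1)[of n], where 'a = real] by simp
    show "real (N n) * real q \<le> real (G n) * real Q ^ n + (real Q ^ n - real (G n)) * real Q ^ n * real q"
      using of_nat_mono[OF N(2)[of n], where 'a = real] G(2)[of n] by (simp add: of_nat_diff)
  qed (use G I in \<open>simp_all flip: of_nat_power\<close>)
  \<comment> \<open>The ratio is zero for \<open>Q = 1\<close>, so \<open>m = 0\<close> is no
    exception.\<close>
  have "0 \<le> (real Q - 1) / real Q" "(real Q - 1) / real Q < 1" using Q by simp_all
  then have "(\<lambda>n. ((real Q - 1) / real Q) ^ n) \<longlonglongrightarrow> 0"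
    by (intro LIMSEQ_power_zero) (simp only: real_norm_def abs_of_nonneg)
  then have lim0: "(\<lambda>n. 1 - real c * ((real Q - 1) / real Q) ^ n) \<longlonglongrightarrow> 1"
    using tendsto_diff[OF tendsto_const tendsto_mult_left] by fastforce
  have g: "g \<longlonglongrightarrow> 1"
  proof (rule tendsto_sandwich[OF always_eventually always_eventually lim0 tendsto_const])
    show "\<forall>n. 1 - real c * ((real Q - 1) / real Q) ^ n \<le> g n"
    proof
      fix n
      have "(real Q ^ n - real c * (real Q - 1) ^ n) / real Q ^ n \<le> real (G n) / real Q ^ n"
        using G'(1)[of n] Qn[of n] by (intro divide_right_mono) auto
      moreover have "(x - real c * y) / x = 1 - real c * (y / x)" if "x > 0" for x y
        using that by (simp add: field_simps)
      ultimately show "1 - real c * ((real Q - 1) / real Q) ^ n \<le> g n"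
        using Qn[of n] by (simp only: g_def power_divide)
    qed
    show "\<forall>n. g n \<le> 1" using G'(2) Qn by (simp add: g_def)
  qed
  have u: "(\<lambda>n. real (I n) / real Q ^ n) \<longlonglongrightarrow> 1"
    by (rule tendsto_sandwich[OF always_eventually always_eventually g tendsto_const])
      (use I' Qn in \<open>auto simp: g_def intro!: divide_right_mono\<close>)
  have up: "(\<lambda>n. g n + (1 - g n) * real q) \<longlonglongrightarrow> 1"
    using g by (auto intro!: tendsto_eq_intros)
  have w: "w \<longlonglongrightarrow> 1"
  proof (rule tendsto_sandwich[OF always_eventually always_eventually g up])
    show "\<forall>n. g n \<le> w n"
    proof
      fix n
      have "real (G n) * real Q ^ n / (real Q ^ n)\<^sup>2 \<le> w n"
        unfolding w_def using N'(1)[of n] by (intro divide_right_mono) auto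
      then show "g n \<le> w n" using Q Qn[of n] by (simp add: g_def power2_eq_square)
    qed
    show "\<forall>n. w n \<le> g n + (1 - g n) * real q"
    proof
      fix n
      have "w n \<le> (real (G n) * real Q ^ n + (real Q ^ n - real (G n)) * real Q ^ n * real q)
          / (real Q ^ n)\<^sup>2"
        unfolding w_def using N'(2)[of n] by (intro divide_right_mono) auto
      also have "\<dots> = g n + (1 - g n) * real q"
        using Q Qn[of n] by (simp add: g_def power2_eq_square field_simps)
      finally show "w n \<le> g n + (1 - g n) * real q" .
    qed
  qed
  have "(\<lambda>n. real q * (real (I n) / real Q ^ n)\<^sup>2 / w n) \<longlonglongrightarrow> real q * 1\<^sup>2 / 1"
    by (intro tendsto_intros u w) simp
  moreover have "real q * (real (I n) / real Q ^ n)\<^sup>2 / w n = (real (I n))\<^sup>2 / real (N n)" for n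
    using Qn[of n] q by (simp add: w_def power_divide)
  ultimately show "(\<lambda>n. (real (I n))\<^sup>2 / real (N n)) \<longlonglongrightarrow> real q" by simp
  have "eventually (\<lambda>n. w n > 0) sequentially"
    using order_tendstoD(1)[OF w, of 0] by simp
  then show "eventually (\<lambda>n. N n > 0) sequentially"
    by (rule eventually_mono) (auto simp: w_def intro: Nat.gr0I)
qed

lemma (in socle_cring) average_injective_homs_tendsto:
  "(\<lambda>n. average_injective_homs R m n) \<longlonglongrightarrow> real (card (carrier R) ^ (m * (m + 1) div 2))"
proof -
  let ?q = "card (carrier R)" and ?t = "m * (m + 1) div 2"
  let ?I = "\<lambda>n. num_injective_homs R m (free_module R n)"
  let ?N = "\<lambda>n. card (isotropic_injections R m n)"
  have nontrivial: "\<one> \<noteq> \<zero>"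
    using s_nonzero r_one[OF s_closed] by (metis r_null s_closed)
  have q: "?q > 0" using finite_carrier zero_closed by (auto simp: card_gt_0_iff)
  have e: "?q ^ (n * m) = (?q ^ m) ^ n" for n by (simp add: mult.commute power_mult)
  have G: "card (unit_row_matrices R m n) \<le> (?q ^ m) ^ n" for n
    using num_injective_homs_free_module_bounds[OF finite_carrier, of m n] by (simp add: e)
  note bounds = card_non_unit_row_matrices[OF finite_carrier, of _ m, unfolded card_matrices e] G
    num_injective_homs_free_module_bounds[OF finite_carrier, of m, unfolded e]
    card_isotropic_injections_bounds[OF finite_carrier nontrivial, of m, unfolded e]
  have Q: "?q ^ m \<ge> 1" "?q ^ ?t > 0" using q by simp_all
  note L = ratio_limit_from_bounds[OF Q bounds]
  \<comment> \<open>The quotient formula requires an isotropic injection to exist, which is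
    guaranteed only for large \<open>n\<close>.\<close>
  have "eventually (\<lambda>n. average_injective_homs R m n = (real (?I n))\<^sup>2 / real (?N n)) sequentially"
    using L(2)
  proof (rule eventually_mono)
    fix n assume "?N n > 0"
    then have "isotropic_injections R m n \<noteq> {}" by auto
    then show "average_injective_homs R m n = (real (?I n))\<^sup>2 / real (?N n)"
      by (rule average_injective_homs_eq)
  qed
  then show ?thesis using L(1) by (simp only: tendsto_cong)
qed

section \<open>Prime power moduli\<close>

text \<open>The case \<open>e = 0\<close>. Every free module is a single point, so the Grassmannian
  has one member and there is one map, which is injective.\<close>

lemma (in cring) average_injective_homs_zero_ring:
  assumes one: "card (carrier R) = 1"
  shows "average_injective_homs R m n = 1"
proof -
  let ?M = "free_module R (2 * n)"
  have fin: "finite (carrier R)" using one card_ge_0_finite[of "carrier R"] by simp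
  have card_M: "card (carrier (free_module R k)) = 1" for k by (simp add: card_free_module one)
  have full: "Z = carrier ?M" if "Z \<in> OGr R n" for Z
  proof -
    have "Z \<noteq> {}" using module.submoduleE(2)[OF module_free_module OGrD(1)[OF that]] .
    moreover obtain z where "carrier ?M = {z}" using card_M[of "2 * n"] by (auto simp: card_1_singleton_iff)
    ultimately show ?thesis using OGr_subset[OF that] by auto
  qed
  then have O: "OGr R n = {carrier ?M}" using OGr_nonempty by blast
  obtain x where "carrier (free_module R m) = {x}"
    using card_M[of m] by (auto simp: card_1_singleton_iff)
  then have "num_injective_homs R m ?M = card (module_hom R (free_module R m) ?M)"
    by (simp add: num_injective_homs_def)
  also have "\<dots> = 1"
    using bij_betw_same_card[OF bij_betw_mat_hom[of m "2 * n"]] by (simp add: card_matrices one)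
  finally show ?thesis by (simp add: average_injective_homs_def O)
qed

lemma ZMod_hom: "ZMod k \<in> ring_hom \<Z> (ZFact k)"
proof -
  have "ZMod k = (+>\<^bsub>\<Z>\<^esub>) (Idl\<^bsub>\<Z>\<^esub> {k})" by (simp add: fun_eq_iff ZMod_def)
  then show ?thesis
    unfolding ZFact_def using ideal.rcos_ring_hom[OF int.genideal_ideal] by simp
qed

lemma carrier_ZFact: "carrier (ZFact k) = range (ZMod k)"
  by (auto simp: ZFact_defs A_RCOSETS_def' ZMod_def)

lemma carrier_ZFact_eq_image:
  assumes "k > 0"
  shows "carrier (ZFact k) = ZMod k ` {0..<k}"
proof -
  have "ZMod k a \<in> ZMod k ` {0..<k}" for a
    using ZMod_mod[of k a] assms by (intro image_eqI[of _ _ "a mod k"]) auto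
  then show ?thesis by (auto simp: carrier_ZFact)
qed

lemma card_carrier_ZFact:
  assumes "k > 0"
  shows "card (carrier (ZFact k)) = nat k"
proof -
  have "inj_on (ZMod k) {0..<k}" by (auto simp: inj_on_def ZMod_eq_mod)
  then show ?thesis by (simp add: carrier_ZFact_eq_image[OF assms] card_image)
qed

lemma ZFact_ops:
  "ZMod k a \<otimes>\<^bsub>ZFact k\<^esub> ZMod k b = ZMod k (a * b)"
  "\<one>\<^bsub>ZFact k\<^esub> = ZMod k 1" "\<zero>\<^bsub>ZFact k\<^esub> = ZMod k 0"
proof -
  show "ZMod k a \<otimes>\<^bsub>ZFact k\<^esub> ZMod k b = ZMod k (a * b)"
    using ring_hom_mult[OF ZMod_hom, of a b] by simp
  show "\<one>\<^bsub>ZFact k\<^esub> = ZMod k 1" using ring_hom_one[OF ZMod_hom] by simp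
  show "\<zero>\<^bsub>ZFact k\<^esub> = ZMod k 0"
    using ring_hom_zero[OF ZMod_hom int.ring_axioms cring.axioms(1)[OF ZFact_is_cring]] by simp
qed

text \<open>Nonunits modulo \<open>p^e\<close> are classes of multiples of \<open>p\<close>, and
  \<open>p^(e - 1)\<close> times such a multiple is divisible by \<open>p^e\<close>. With
  \<open>e > 0\<close> the element \<open>p^(e - 1)\<close> is itself nonzero.\<close>

lemma socle_cring_ZFact:
  fixes p e q :: nat
  assumes p: "Factorial_Ring.prime p" and e: "e > 0" and q: "q = p ^ e"
  shows "socle_cring (ZFact (int q)) (ZMod (int q) (int (p ^ (e - 1))))"
proof -
  let ?R = "ZFact (int q)" and ?Z = "ZMod (int q)"
  interpret R: cring ?R by (rule ZFact_is_cring)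
  have q0: "int q > 0" using q p by (simp add: prime_gt_0_nat)
  have pe: "p ^ e = p ^ (e - 1) * p" using e by (metis power_minus_mult)
  show ?thesis
  proof unfold_locales
    show "finite (carrier ?R)" by (simp add: carrier_ZFact_eq_image[OF q0])
    show "?Z (int (p ^ (e - 1))) \<in> carrier ?R" by (simp add: carrier_ZFact)
    have "p ^ (e - 1) < q" using e q p prime_gt_1_nat by (simp add: power_strict_increasing)
    moreover have "p ^ (e - 1) > 0" using p by (simp add: prime_gt_0_nat)
    ultimately have "\<not> q dvd p ^ (e - 1)" by (rule nat_dvd_not_less[rotated])
    then have "int (p ^ (e - 1)) mod int q \<noteq> 0"
      unfolding mod_eq_0_iff_dvd int_dvd_int_iff .
    then show "?Z (int (p ^ (e - 1))) \<noteq> \<zero>\<^bsub>?R\<^esub>" by (simp add: ZFact_ops ZMod_eq_mod)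
    fix x assume x: "x \<in> carrier ?R" "x \<notin> Units ?R"
    then obtain a where a: "x = ?Z a" by (auto simp: carrier_ZFact)
    \<comment> \<open>A number prime to \<open>p\<close> is prime to \<open>q\<close>, and a Bezout
      coefficient is then its inverse modulo \<open>q\<close>.\<close>
    have "int p dvd a"
    proof (rule ccontr)
      assume "\<not> int p dvd a"
      then have "coprime (int p) a" using p by (simp add: prime_imp_coprime)
      then have "coprime a (int q)" by (simp add: q coprime_commute)
      then obtain b c where bc: "b * a + c * int q = 1" using bezout_int[of a "int q"] by auto
      have "(a * b) mod int q = (a * b + c * int q) mod int q" by simp
      also have "\<dots> = 1 mod int q" using bc by (simp add: mult.commute)
      finally have "x \<otimes>\<^bsub>?R\<^esub> ?Z b = \<one>\<^bsub>?R\<^esub>" by (simp add: a ZFact_ops ZMod_eq_mod)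
      moreover have "?Z b \<in> carrier ?R" by (simp add: carrier_ZFact)
      ultimately have "x \<in> Units ?R"
        using x(1) R.m_comm[of x "?Z b"] unfolding Units_def by auto
      with x(2) show False by simp
    qed
    then obtain c where "a = int p * c" by blast
    then have "int (p ^ (e - 1)) * a = int q * c" by (simp add: q pe)
    then show "?Z (int (p ^ (e - 1))) \<otimes>\<^bsub>?R\<^esub> x = \<zero>\<^bsub>?R\<^esub>"
      by (simp add: a ZFact_ops ZMod_eq_mod)
  qed
qed

theorem theorem5p10:
  fixes p e q m :: nat
  assumes "Factorial_Ring.prime p"
    and "q = p ^ e"
  shows "(\<lambda>n. average_injective_homs (ZFact (int q)) m n)
           \<longlonglongrightarrow> real q ^ (m * (m + 1) div 2)"
proof -
  interpret R: cring "ZFact (int q)" by (rule ZFact_is_cring)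
  have "q > 0" using assms by (simp add: prime_gt_0_nat)
  then have card: "card (carrier (ZFact (int q))) = q" using card_carrier_ZFact[of "int q"] by simp
  show ?thesis
  proof (cases "e = 0")
    case True
    then show ?thesis using R.average_injective_homs_zero_ring card assms(2) by simp
  next
    case False
    then show ?thesis
      using socle_cring.average_injective_homs_tendsto[OF socle_cring_ZFact[OF assms(1) _ assms(2)], of m]
      by (simp only: card of_nat_power neq0_conv)
  qed
qed

end
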